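(* Let $\alpha\in(0,1)$, $\beta\in(0,1-\alpha)$. For the testing problem $H_0:\pi=\pi_0$ versus $H_1:W_1(\pi,\pi_0)\ge\epsilon$ based on $X_1,\dots,X_n$ i.i.d. from $P_\pi$, where $\pi_0\in D$ is an arbitrary known distribution on $[0,1]$, let $\psi=I\big(\hat\ell_2(X)>q_\alpha(P_{\pi_0},\hat\ell_2)\big)$ be the debiased Pearson's $\chi^2$ test (defined in the context). Then $P_{\pi_0}^n(\psi(X)=1)\le\alpha$. Furthermore, for any constant $\delta>0$ there exist a positive constant $C_\delta$, positive constants $c_1,c_2$ and an integer $n_0$ (all depending only on $\delta,\alpha,\beta$) such that for all $n\ge n_0$ and all $\pi_0\in D$, $\sup_{\pi\in D:\,W_1(\pi,\pi_0)\ge\epsilon}P_\pi^n(\psi(X)=0)\le\beta$ whenever $$\epsilon\ \ge\ C_\delta\cdot\begin{cases}\dfrac1t & \text{for } t\le c_1\log n,\\[2mm] \dfrac{1}{\sqrt{t\log n}} & \text{for } c_1\log n\le t\le c_2\,\dfrac{n^{1/4-\delta}}{(\log n)^{3/8}}.\end{cases}$$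
   Context: $t\ge1$, $n\ge2$ are integers. $D$ is the set of all probability distributions on $[0,1]$. For $\pi\in D$ and $0\le j\le t$, $b_{j,t}(\pi)=E_{p\sim\pi}\big[\binom tj p^j(1-p)^{t-j}\big]$, and $P_\pi$ is the distribution on $\{0,\dots,t\}$ with $P_\pi(\{j\})=b_{j,t}(\pi)$; $P_\pi^n$ is its $n$-fold product and $X=(X_1,\dots,X_n)$. $W_1$ is the 1-Wasserstein distance. $I(\cdot)$ is the indicator. For a statistic $T$, $q_\alpha(P_{\pi_0},T)=\inf\{u:P_{\pi_0}^n(T(X)>u)\le\alpha\}$. For $x\in[0,1]$ write $\mu_x=x(1-x)$. Let $n_j=\sum_{i=1}^nI(X_i=j)$, $j=0,\dots,t$. The statistic is $$\hat\ell_2(X)=\frac1{t+1}\sum_{j=0}^t\frac{\tilde K_2(n_j,b_{j,t}(\pi_0),n)}{\max\big(\frac1{t+1},\mu_{b_{j,t}(\pi_0)}\big)},\qquad \tilde K_2(n_j,b,n)=\Big(\frac{n_j}n-b\Big)^2-\frac{\mu_{n_j/n}}{n-1}.$$ *)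

theory Defs
  imports "HOL-Probability.Probability"
begin

definition dists01 :: "real measure set" where
  "dists01 = {\<pi>. prob_space \<pi> \<and> sets \<pi> = sets (restrict_space borel {0..1})}"

definition couplings :: "real measure \<Rightarrow> real measure \<Rightarrow> (real \<times> real) measure set" where
  "couplings \<pi> \<rho> = {\<gamma>. prob_space \<gamma> \<and> sets \<gamma> = sets (\<pi> \<Otimes>\<^sub>M \<rho>) \<and>
     distr \<gamma> \<pi> fst = \<pi> \<and> distr \<gamma> \<rho> snd = \<rho>}"

definition W1 :: "real measure \<Rightarrow> real measure \<Rightarrow> real" where
  "W1 \<pi> \<rho> = (INF \<gamma>\<in>couplings \<pi> \<rho>. \<integral>z. \<bar>fst z - snd z\<bar> \<partial>\<gamma>)"

definition b_coef :: "nat \<Rightarrow> nat \<Rightarrow> real measure \<Rightarrow> real" where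
  "b_coef j t \<pi> = (\<integral>p. real (t choose j) * p ^ j * (1 - p) ^ (t - j) \<partial>\<pi>)"

definition mixture :: "nat \<Rightarrow> real measure \<Rightarrow> nat measure" where
  "mixture t \<pi> = point_measure {0..t} (\<lambda>j. ennreal (b_coef j t \<pi>))"

definition iid :: "nat \<Rightarrow> nat measure \<Rightarrow> (nat \<Rightarrow> nat) measure" where
  "iid n P = PiM {1..n} (\<lambda>_. P)"

definition quantile :: "nat \<Rightarrow> real \<Rightarrow> nat measure \<Rightarrow> ((nat \<Rightarrow> nat) \<Rightarrow> real) \<Rightarrow> real" where
  "quantile n \<alpha> P T = Inf {u. measure (iid n P) {x \<in> space (iid n P). T x > u} \<le> \<alpha>}"

definition mu :: "real \<Rightarrow> real" where
  "mu x = x * (1 - x)"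

definition count_eq :: "nat \<Rightarrow> (nat \<Rightarrow> nat) \<Rightarrow> nat \<Rightarrow> nat" where
  "count_eq n x j = (\<Sum>i=1..n. of_bool (x i = j))"

definition K2 :: "nat \<Rightarrow> real \<Rightarrow> nat \<Rightarrow> real" where
  "K2 m q n = (real m / real n - q)\<^sup>2 - mu (real m / real n) / (real n - 1)"

definition l2_stat :: "nat \<Rightarrow> nat \<Rightarrow> real measure \<Rightarrow> (nat \<Rightarrow> nat) \<Rightarrow> real" where
  "l2_stat t n \<pi>0 x = 1 / (real t + 1) *
     (\<Sum>j=0..t. K2 (count_eq n x j) (b_coef j t \<pi>0) n / max (1 / (real t + 1)) (mu (b_coef j t \<pi>0)))"

definition psi :: "nat \<Rightarrow> nat \<Rightarrow> real \<Rightarrow> real measure \<Rightarrow> (nat \<Rightarrow> nat) \<Rightarrow> nat" where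
  "psi t n \<alpha> \<pi>0 x =
     of_bool (l2_stat t n \<pi>0 x > quantile n \<alpha> (mixture t \<pi>0) (l2_stat t n \<pi>0))"

text \<open>The supremum of an empty set of probabilities is \<open>0\<close> in \<^typ>\<open>ennreal\<close>, but unspecified
  in \<^typ>\<open>real\<close>; it does occur, since no alternative is left once \<open>\<epsilon> > 1\<close>.\<close>

definition max_type2_error :: "nat \<Rightarrow> nat \<Rightarrow> real \<Rightarrow> real measure \<Rightarrow> real \<Rightarrow> ennreal" where
  "max_type2_error t n \<alpha> \<pi>0 \<epsilon> =
     (SUP \<pi>\<in>{\<pi> \<in> dists01. W1 \<pi> \<pi>0 \<ge> \<epsilon>}.
        emeasure (iid n (mixture t \<pi>)) {x \<in> space (iid n (mixture t \<pi>)). psi t n \<alpha> \<pi>0 x = 0})"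

end

theory Submission
  imports Defs
begin

text \<open>The test has power as soon as the weighted squared distance
  \<open>\<Delta> = (\<Sum>j\<le>t. v\<^sub>j * (b\<^sub>j(\<pi>) - b\<^sub>j(\<pi>0))\<^sup>2)\<close> between the two vectors of Bernstein moments is at
  least a constant over \<open>n\<close>, where \<open>v\<^sub>j = 1 / max 1 ((t + 1) * mu b\<^sub>j(\<pi>0))\<close>.  The debiasing term of the
  statistic is at most \<open>2 / n\<close>, so up to that error the statistic is the same weighted squared distance
  between the empirical frequencies and \<open>b(\<pi>0)\<close>.  The empirical frequencies are, in expectation, within
  \<open>1 / n\<close> in this distance of the distribution that generated them, because all weights are at most
  \<open>1\<close> and \<open>b\<^sub>j * (1 - b\<^sub>j)\<close> is at most \<open>b\<^sub>j\<close>.  Markov's inequality under the hypothesis bounds the quantile by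
  \<open>1 / (n * \<alpha>)\<close>, and Markov's inequality under the alternative bounds the error of the second kind
  (\<open>type2_error_bound\<close>).  No variance of the statistic is needed.

  It remains to bound \<open>\<Delta>\<close> from below when \<open>W1 \<pi> \<pi>0\<close> is large (\<open>separation_from_W1\<close>).  By the quantile
  coupling there is a 1-Lipschitz \<open>f\<close> with \<open>W1 \<pi> \<pi>0 \<le> \<integral>f d\<pi> - \<integral>f d\<pi>0\<close> (\<open>W1_le_dual\<close>).  If \<open>f\<close> is
  approximated within \<open>2 / (m + 1)\<close> by a combination of the Bernstein polynomials of degree \<open>t\<close> with
  coefficients bounded by \<open>A\<close>, then \<open>W1 \<pi> \<pi>0 \<ge> 8 / (m + 1)\<close> forces
  \<open>4 / (m + 1) \<le> A * (\<Sum>j\<le>t. \<bar>b\<^sub>j(\<pi>) - b\<^sub>j(\<pi>0)\<bar>)\<close>, and the Cauchy-Schwarz inequality together with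
  \<open>(\<Sum>j\<le>t. 1 / v\<^sub>j) \<le> 2 * (t + 1)\<close> turns this into a bound on \<open>\<Delta>\<close>.

  The approximation (\<open>lipschitz_bernstein_approximation\<close>) has the Jackson rate \<open>1 / m\<close> for any \<open>m \<le> t\<close>,
  with \<open>A\<close> of order \<open>t * (1 + ln m) * exp (2 * m\<^sup>2 / t)\<close> for \<open>m \<ge> 1\<close>.  The substitution \<open>x = sin(\<theta>/2)\<^sup>2\<close> makes \<open>f\<close> an even
  Lipschitz function of \<open>\<theta>\<close>, which is averaged over equispaced nodes against a nonnegative
  trigonometric kernel of degree \<open>m\<close>; the result is a combination of the functions \<open>cos (l * \<theta>)\<close>, \<open>l \<le> m\<close>,
  whose coefficients are controlled by the decay of Fourier coefficients.  Each \<open>cos (l * \<theta>)\<close> is,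
  up to sign, the Chebyshev polynomial of degree \<open>l\<close> moved to \<open>[0, 1]\<close>, and its
  Bernstein coefficients of degree \<open>t\<close> are at most \<open>(t + 1) * exp (2 * l\<^sup>2 / t)\<close>
  (\<open>cos_multiple_bernstein_form\<close>): they are the coefficients of an explicit polynomial divided
  by binomial coefficients, and Cauchy's estimate on a suitable circle applies.

  In the theorem, \<open>m = t\<close> is taken for \<open>t \<le> c1 * ln n\<close>, and \<open>m\<close> of order \<open>sqrt (c1 * t * ln n)\<close> otherwise.
  In both cases \<open>exp (2 * m\<^sup>2 / t) \<le> n powr (2 * c1)\<close>, and the inequality needed to get
  \<open>\<Delta> \<ge> const / n\<close> is \<open>degree_budget\<close>.\<close>

section \<open>Averages over roots of unity\<close>

lemma sum_roots_of_unity: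
  fixes l :: int and N :: nat
  assumes "N > 0" "\<not> int N dvd l"
  shows "(\<Sum>s<N. cis (2 * pi * of_int l * of_nat s / of_nat N)) = 0"
proof -
  define w where "w = cis (2 * pi * of_int l / of_nat N)"
  have pow: "cis (2 * pi * of_int l * of_nat s / of_nat N) = w ^ s" for s
    unfolding w_def Complex.DeMoivre by (rule arg_cong[where f = cis]) simp
  have w1: "w \<noteq> 1"
  proof
    assume "w = 1"
    then have "exp (\<i> * of_real (2 * pi * of_int l / of_nat N)) = 1"
      by (simp add: w_def cis_conv_exp)
    then obtain k :: int where k: "2 * pi * of_int l / of_nat N = of_int (2 * k) * pi"
      unfolding exp_eq_1 by auto
    then have "real_of_int l = of_int (k * int N)"
      using assms(1) by (simp add: field_simps)
    then have "l = k * int N" by (simp only: of_int_eq_iff)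
    with assms(2) show False by simp
  qed
  have "w ^ N = cis (2 * pi * of_int l)"
    using assms(1) pow[of N] by simp
  also have "\<dots> = 1"
    using cis_multiple_2pi[of "of_int l"] by simp
  finally have "w ^ N = 1" .
  then show ?thesis
    by (simp add: pow geometric_sum[OF w1])
qed

lemma average_cos_equispaced:
  fixes l :: int and N :: nat
  assumes "\<bar>l\<bar> < int N"
  shows "(\<Sum>s<N. cos (of_int l * (\<theta> - 2 * pi * of_nat s / of_nat N))) / of_nat N
         = (if l = 0 then 1 else 0 :: real)"
proof (cases "l = 0")
  case True
  then show ?thesis using assms by simp
next
  case False
  then have nd: "\<not> int N dvd - l"
    using assms by (metis dvd_imp_le_int linorder_not_less minus_dvd_iff dvd_minus_iff abs_of_nat)
  have "(\<Sum>s<N. cis (of_int l * (\<theta> - 2 * pi * of_nat s / of_nat N)))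
      = cis (of_int l * \<theta>) * (\<Sum>s<N. cis (2 * pi * of_int (- l) * of_nat s / of_nat N))"
    by (simp add: sum_distrib_left cis_mult algebra_simps)
  also have "\<dots> = 0"
    using sum_roots_of_unity[OF _ nd] assms by simp
  finally have "Re (\<Sum>s<N. cis (of_int l * (\<theta> - 2 * pi * of_nat s / of_nat N))) = 0"
    by simp
  then show ?thesis using False by simp
qed

text \<open>Cauchy's estimate for polynomials.  The coefficient is recovered by averaging over the
  \<open>N\<close>-th roots of unity, where \<open>N\<close> exceeds \<open>j\<close> and the degree so that no two exponents alias.\<close>
lemma coeff_le_max_on_circle:
  fixes p :: "complex poly" and r M :: real
  assumes "r \<ge> 0" and M: "\<And>z. cmod z = r \<Longrightarrow> cmod (poly p z) \<le> M"
  shows "cmod (coeff p j) * r ^ j \<le> M"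
proof -
  define N where "N = Suc (max j (degree p))"
  define w where "w s = cis (2 * pi * of_nat s / of_nat N)" for s :: nat
  have "(\<Sum>s<N. poly p (of_real r * w s) * cis (- (2 * pi * of_nat j * of_nat s / of_nat N)))
      = (\<Sum>s<N. \<Sum>i\<le>degree p. coeff p i * of_real r ^ i *
            cis (2 * pi * of_int (int i - int j) * of_nat s / of_nat N))"
    unfolding poly_altdef sum_distrib_right
  proof (intro sum.cong refl)
    fix s i
    have "w s ^ i * cis (- (2 * pi * of_nat j * of_nat s / of_nat N))
        = cis (2 * pi * of_int (int i - int j) * of_nat s / of_nat N)"
      unfolding w_def Complex.DeMoivre cis_mult
      by (rule arg_cong[where f = cis]) (simp add: algebra_simps diff_divide_distrib)
    then show "coeff p i * (of_real r * w s) ^ i *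
        cis (- (2 * pi * of_nat j * of_nat s / of_nat N))
      = coeff p i * of_real r ^ i * cis (2 * pi * of_int (int i - int j) * of_nat s / of_nat N)"
      by (simp add: power_mult_distrib mult_ac)
  qed
  also have "\<dots> = (\<Sum>i\<le>degree p. coeff p i * of_real r ^ i *
      (\<Sum>s<N. cis (2 * pi * of_int (int i - int j) * of_nat s / of_nat N)))"
    by (subst sum.swap) (simp add: sum_distrib_left)
  also have "\<dots> = (\<Sum>i\<le>degree p. if i = j then coeff p j * of_real r ^ j * of_nat N else 0)"
  proof (intro sum.cong refl)
    fix i assume i: "i \<in> {..degree p}"
    show "coeff p i * of_real r ^ i *
        (\<Sum>s<N. cis (2 * pi * of_int (int i - int j) * of_nat s / of_nat N))
      = (if i = j then coeff p j * of_real r ^ j * of_nat N else 0)"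
    proof (cases "i = j")
      case True
      then show ?thesis by simp
    next
      case False
      have "\<not> int N dvd int i - int j"
      proof
        assume "int N dvd int i - int j"
        then have "int N \<le> \<bar>int i - int j\<bar>"
          using False dvd_imp_le_int[of "int i - int j" "int N"] by simp
        then show False using i by (auto simp: N_def)
      qed
      then show ?thesis
        using False sum_roots_of_unity[of N "int i - int j"] by (simp add: N_def)
    qed
  qed
  also have "\<dots> = coeff p j * of_real r ^ j * of_nat N"
    by (auto simp: coeff_eq_0)
  finally have eq: "coeff p j * of_real r ^ j * of_nat N
     = (\<Sum>s<N. poly p (of_real r * w s) * cis (- (2 * pi * of_nat j * of_nat s / of_nat N)))" ..
  have "cmod (coeff p j) * r ^ j * real N = cmod (coeff p j * of_real r ^ j * of_nat N)"
    using assms(1) by (simp add: norm_mult norm_power)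
  also have "\<dots> \<le> (\<Sum>s<N. M)"
    unfolding eq
  proof (rule sum_norm_le)
    fix s
    have "cmod (of_real r * w s) = r"
      using assms(1) by (simp add: norm_mult w_def)
    from M[OF this]
    show "cmod (poly p (of_real r * w s) * cis (- (2 * pi * of_nat j * of_nat s / of_nat N))) \<le> M"
      by (simp add: norm_mult)
  qed
  finally show ?thesis by (simp add: N_def mult.commute)
qed

section \<open>Bernstein polynomials\<close>

text \<open>The Bernstein basis polynomial \<open>B\<^sub>j\<close> of degree \<open>t\<close>, normalised as the binomial probability
  of \<open>j\<close> successes; it is the integrand of \<^const>\<open>b_coef\<close>.\<close>
definition bernstein :: "nat \<Rightarrow> nat \<Rightarrow> real \<Rightarrow> real" where
  "bernstein t j x = real (t choose j) * x ^ j * (1 - x) ^ (t - j)"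

lemma bernstein_nonneg: "x \<in> {0..1} \<Longrightarrow> 0 \<le> bernstein t j x"
  by (simp add: bernstein_def)

lemma sum_bernstein: "(\<Sum>j\<le>t. bernstein t j x) = 1"
  using binomial_ring[of x "1 - x" t] by (simp add: bernstein_def)

lemma bernstein_Suc_ratio:
  assumes "i < t"
  shows "real (i + 1) * (1 - x) * bernstein t (Suc i) x = real (t - i) * x * bernstein t i x"
proof -
  have b: "real (Suc i) * real (t choose Suc i) = real (t - i) * real (t choose i)"
    unfolding of_nat_mult[symmetric] binomial_absorption binomial_absorb_comp ..
  have e: "(1 - x) ^ (t - i) = (1 - x) * (1 - x) ^ (t - Suc i)"
    using assms by (metis Suc_diff_Suc power_Suc)
  have "real (i + 1) * (1 - x) * bernstein t (Suc i) x
     = (real (Suc i) * real (t choose Suc i)) * x ^ Suc i * (1 - x) ^ (t - i)"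
    by (simp add: bernstein_def e)
  also have "\<dots> = real (t - i) * x * bernstein t i x"
    unfolding b by (simp add: bernstein_def)
  finally show ?thesis .
qed

text \<open>At \<open>x = (j + 1/2) / (t + 1)\<close> the binomial distribution has its mode at \<open>j\<close>, so the
  probability of \<open>j\<close> is at least the mean \<open>1 / (t + 1)\<close> of all \<open>t + 1\<close> probabilities.  The shift by one
  half keeps \<open>x\<close> inside the open interval also for \<open>j = 0\<close> and \<open>j = t\<close>.\<close>
lemma bernstein_mode:
  assumes "j \<le> t"
  defines "x \<equiv> (real j + 1 / 2) / (real t + 1)"
  shows "0 < x" "x < 1" "1 \<le> (real t + 1) * bernstein t j x"
proof -
  show x0: "0 < x" and x1: "x < 1" using assms by (auto simp: x_def field_simps)
  have nn: "0 \<le> bernstein t i x" for i using x0 x1 by (simp add: bernstein_nonneg)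
  have tx: "(real t + 1) * x = real j + 1 / 2" by (simp add: x_def)
  have up: "bernstein t i x \<le> bernstein t (Suc i) x" if "i < j" for i
  proof -
    have it: "i < t" using that assms by simp
    have "real i + 1 \<le> real j" using that by linarith
    then have "real (i + 1) * (1 - x) \<le> real (t - i) * x"
      using it tx by (simp add: of_nat_diff algebra_simps)
    then have "real (i + 1) * (1 - x) * bernstein t i x \<le> real (t - i) * x * bernstein t i x"
      by (rule mult_right_mono) (rule nn)
    also have "\<dots> = real (i + 1) * (1 - x) * bernstein t (Suc i) x"
      by (rule bernstein_Suc_ratio[OF it, symmetric])
    finally show ?thesis using x1 by simp
  qed
  have down: "bernstein t (Suc i) x \<le> bernstein t i x" if "j \<le> i" "i < t" for i
  proof -
    have "real j \<le> real i" using that by linarith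
    then have "real (t - i) * x \<le> real (i + 1) * (1 - x)"
      using that tx by (simp add: of_nat_diff algebra_simps)
    then have "real (t - i) * x * bernstein t i x \<le> real (i + 1) * (1 - x) * bernstein t i x"
      by (rule mult_right_mono) (rule nn)
    then have "real (i + 1) * (1 - x) * bernstein t (Suc i) x \<le> real (i + 1) * (1 - x) * bernstein t i x"
      by (simp only: bernstein_Suc_ratio[OF that(2)])
    then show ?thesis using x1 by simp
  qed
  have max: "bernstein t i x \<le> bernstein t j x" if "i \<le> t" for i
  proof (cases "i \<le> j")
    case True
    then show ?thesis
      by (induction rule: inc_induct) (use up in \<open>auto intro: order_trans\<close>)
  next
    case False
    then have "j \<le> i" by simp
    then show ?thesis using that
    proof (induction rule: dec_induct)
      case (step k)
      then show ?case using down[of k] by linarith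
    qed simp
  qed
  have "1 = (\<Sum>i\<le>t. bernstein t i x)" by (simp add: sum_bernstein)
  also have "\<dots> \<le> (\<Sum>i\<le>t. bernstein t j x)" by (intro sum_mono max) simp
  finally show "1 \<le> (real t + 1) * bernstein t j x" by (simp add: algebra_simps)
qed

section \<open>Bernstein coefficients of Chebyshev polynomials\<close>

text \<open>The numerator of \<open>cos (l * \<theta>)\<close> as a rational function of \<open>z = tan(\<theta>/2)\<^sup>2\<close>: one has
  \<open>cos (l * \<theta>) = cheb_num l z / (1 + z) ^ l\<close>.  The recursion is the one of the Chebyshev polynomials after
  clearing the denominators of \<open>cos \<theta> = (1 - z) / (1 + z)\<close>.  Complex coefficients are used, although all
  of them are real, because the polynomial is evaluated on circles.\<close>
fun cheb_num :: "nat \<Rightarrow> complex poly" where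
  "cheb_num 0 = 1"
| "cheb_num (Suc 0) = [:1, -1:]"
| "cheb_num (Suc (Suc l)) = 2 * [:1, -1:] * cheb_num (Suc l) - [:1, 1:]\<^sup>2 * cheb_num l"

lemma degree_cheb_num: "degree (cheb_num l) \<le> l"
proof (induction l rule: cheb_num.induct)
  case (3 l)
  have "degree (2 * [:1, -1:] * cheb_num (Suc l)) \<le> Suc (Suc l)"
  proof -
    have "degree (2 * [:1, -1:] * cheb_num (Suc l)) \<le> degree (2 * [:1, -1::complex:]) + degree (cheb_num (Suc l))"
      by (rule degree_mult_le)
    also have "\<dots> = 1 + degree (cheb_num (Suc l))" by (simp add: numeral_poly)
    also have "\<dots> \<le> Suc (Suc l)" using 3 by simp
    finally show ?thesis .
  qed
  moreover have "degree ([:1, 1:]\<^sup>2 * cheb_num l) \<le> Suc (Suc l)"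
  proof -
    have "degree ([:1, 1::complex:]\<^sup>2 * cheb_num l) \<le> degree ([:1, 1::complex:]\<^sup>2) + degree (cheb_num l)"
      by (rule degree_mult_le)
    also have "\<dots> \<le> 2 + l"
      using 3 degree_power_le[of "[:1, 1::complex:]" 2] by simp
    finally show ?thesis by simp
  qed
  ultimately show ?case by (simp only: cheb_num.simps degree_diff_le)
qed simp_all

lemma poly_cheb_num_tan:
  assumes c: "cos (\<theta> / 2) \<noteq> 0"
  shows "poly (cheb_num l) (of_real ((tan (\<theta> / 2))\<^sup>2)) * of_real (cos (\<theta> / 2) ^ (2 * l))
         = of_real (cos (real l * \<theta>))"
proof -
  define z where "z = complex_of_real ((tan (\<theta> / 2))\<^sup>2)"
  define C where "C = complex_of_real ((cos (\<theta> / 2))\<^sup>2)"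
  have cos: "cos \<theta> = (cos (\<theta> / 2))\<^sup>2 - (sin (\<theta> / 2))\<^sup>2"
    using cos_double[of "\<theta> / 2"] by simp
  have zC: "z * C = of_real ((sin (\<theta> / 2))\<^sup>2)"
  proof -
    have "(tan (\<theta> / 2))\<^sup>2 * (cos (\<theta> / 2))\<^sup>2 = (sin (\<theta> / 2))\<^sup>2"
      using c by (simp add: tan_def power_divide)
    then show ?thesis unfolding z_def C_def by (metis of_real_mult)
  qed
  have m: "(1 - z) * C = of_real (cos \<theta>)"
    unfolding left_diff_distrib zC by (simp add: cos C_def)
  have p: "(1 + z) * C = 1"
    unfolding distrib_right zC by (simp add: C_def del: of_real_power flip: of_real_add)
  have "poly (cheb_num l) z * C ^ l = of_real (cos (real l * \<theta>))"
  proof (induction l rule: cheb_num.induct)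
    case 2
    then show ?case using m by simp
  next
    case (3 l)
    have "poly (cheb_num (Suc (Suc l))) z * C ^ Suc (Suc l)
        = 2 * ((1 - z) * C) * (poly (cheb_num (Suc l)) z * C ^ Suc l)
          - ((1 + z) * C)\<^sup>2 * (poly (cheb_num l) z * C ^ l)"
      by (simp add: algebra_simps power2_eq_square)
    also have "\<dots> = of_real (2 * cos \<theta> * cos (real (Suc l) * \<theta>) - cos (real l * \<theta>))"
      by (simp only: m p 3) simp
    also have "2 * cos \<theta> * cos (real (Suc l) * \<theta>) - cos (real l * \<theta>)
      = cos (real (Suc (Suc l)) * \<theta>)"
    proof -
      have "real (Suc (Suc l)) * \<theta> = real (Suc l) * \<theta> + \<theta>" "real l * \<theta> = real (Suc l) * \<theta> - \<theta>"
        by (simp_all add: algebra_simps)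
      then show ?thesis by (simp only: cos_add cos_diff) simp
    qed
    finally show ?case .
  qed simp
  then show ?thesis by (simp add: z_def C_def power_mult)
qed

text \<open>The closed form that makes the size of \<^const>\<open>cheb_num\<close> at complex points visible.\<close>
lemma poly_cheb_num_square:
  "2 * poly (cheb_num l) (s\<^sup>2) = (1 + \<i> * s) ^ (2 * l) + (1 - \<i> * s) ^ (2 * l)"
proof -
  define a where "a = (1 + \<i> * s)\<^sup>2"
  define b where "b = (1 - \<i> * s)\<^sup>2"
  have ii: "\<i>\<^sup>2 = -1" by simp
  have ab: "a + b = 2 * (1 - s\<^sup>2)"
    by (simp add: a_def b_def power2_eq_square algebra_simps)
  have ab': "a * b = (1 + s\<^sup>2)\<^sup>2"
  proof -
    have "a * b = ((1 + \<i> * s) * (1 - \<i> * s))\<^sup>2"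
      by (simp add: a_def b_def power_mult_distrib)
    also have "(1 + \<i> * s) * (1 - \<i> * s) = 1 + s\<^sup>2"
      by (simp add: power2_eq_square algebra_simps)
    finally show ?thesis .
  qed
  have "2 * poly (cheb_num l) (s\<^sup>2) = a ^ l + b ^ l"
  proof (induction l rule: cheb_num.induct)
    case 2
    then show ?case by (simp add: ab)
  next
    case (3 l)
    have "2 * poly (cheb_num (Suc (Suc l))) (s\<^sup>2)
      = 2 * (1 - s\<^sup>2) * (2 * poly (cheb_num (Suc l)) (s\<^sup>2)) - (1 + s\<^sup>2)\<^sup>2 * (2 * poly (cheb_num l) (s\<^sup>2))"
      by (simp add: algebra_simps power2_eq_square)
    also have "\<dots> = (a + b) * (a ^ Suc l + b ^ Suc l) - a * b * (a ^ l + b ^ l)"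
      by (simp only: ab ab' 3)
    also have "\<dots> = a ^ Suc (Suc l) + b ^ Suc (Suc l)"
      by (simp add: algebra_simps)
    finally show ?case .
  qed simp
  then show ?thesis by (simp add: a_def b_def power_mult)
qed

lemma chebyshev_growth:
  fixes y :: real
  assumes y: "0 \<le> y" "y \<le> 1" and l: "l \<le> t" and t: "0 < t"
  shows "(1 + y) ^ l * sqrt (1 - y\<^sup>2) ^ (t - l) \<le> exp (2 * (real l)\<^sup>2 / real t)"
proof -
  have y2: "y\<^sup>2 \<le> 1" using y by (simp add: power_le_one)
  have e: "1 + y \<le> exp y" by (rule exp_ge_add_one_self)
  have le: "(1 + y) ^ l \<le> exp (real l * y)"
    using power_mono[OF e, of l] y by (simp add: exp_of_nat_mult)
  have s1: "sqrt (1 - y\<^sup>2) \<le> exp (- y\<^sup>2 / 2)"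
  proof (rule real_le_lsqrt)
    have "1 - y\<^sup>2 \<le> exp (- y\<^sup>2)" using exp_ge_add_one_self[of "- y\<^sup>2"] by simp
    also have "\<dots> = (exp (- y\<^sup>2 / 2))\<^sup>2" by (simp flip: exp_double)
    finally show "1 - y\<^sup>2 \<le> (exp (- y\<^sup>2 / 2))\<^sup>2" .
  qed simp
  have s0: "0 \<le> sqrt (1 - y\<^sup>2)" using y2 by simp
  show ?thesis
  proof (cases "2 * l \<le> t")
    case True
    have "sqrt (1 - y\<^sup>2) ^ (t - l) \<le> exp (real (t - l) * (- y\<^sup>2 / 2))"
      using power_mono[OF s1 s0, of "t - l"] by (simp only: exp_of_nat_mult)
    also have "\<dots> \<le> exp (- (real t * y\<^sup>2 / 4))"
    proof -
      have "real t / 2 \<le> real (t - l)" using True l by (simp add: of_nat_diff)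
      then have "real t / 2 * (y\<^sup>2 / 2) \<le> real (t - l) * (y\<^sup>2 / 2)"
        by (intro mult_right_mono) simp_all
      then show ?thesis by simp
    qed
    finally have "(1 + y) ^ l * sqrt (1 - y\<^sup>2) ^ (t - l) \<le> exp (real l * y) * exp (- (real t * y\<^sup>2 / 4))"
      using y s0 by (intro mult_mono le) simp_all
    also have "\<dots> = exp (real l * y - real t * y\<^sup>2 / 4)" by (simp flip: exp_add)
    also have "\<dots> \<le> exp (2 * (real l)\<^sup>2 / real t)"
    proof -
      have "real t * (real l * y - real t * y\<^sup>2 / 4) = (real l)\<^sup>2 - (real l - real t * y / 2)\<^sup>2"
        by (simp add: power2_eq_square algebra_simps)
      also have "\<dots> \<le> 2 * (real l)\<^sup>2"
        using zero_le_power2[of "real l - real t * y / 2"] zero_le_power2[of "real l"] by linarith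
      finally have "real l * y - real t * y\<^sup>2 / 4 \<le> 2 * (real l)\<^sup>2 / real t"
        using t by (simp add: pos_le_divide_eq mult.commute)
      then show ?thesis by simp
    qed
    finally show ?thesis .
  next
    case False
    have "(1 + y) ^ l * sqrt (1 - y\<^sup>2) ^ (t - l) \<le> exp (real l * y) * 1"
      using y s0 by (intro mult_mono le power_le_one) simp_all
    also have "\<dots> \<le> exp (real l)" using y by (simp add: mult_left_le)
    also have "\<dots> \<le> exp (2 * (real l)\<^sup>2 / real t)"
    proof -
      have "real l * real t \<le> real l * (2 * real l)" using False by (intro mult_left_mono) simp_all
      then have "real l \<le> 2 * (real l)\<^sup>2 / real t"
        using t by (simp add: pos_le_divide_eq power2_eq_square mult_ac)
      then show ?thesis by simp
    qed
    finally show ?thesis .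
  qed
qed

text \<open>With \<open>s\<^sup>2 = z\<close>, the numbers \<open>p = \<bar>1 + \<i> s\<bar>\<^sup>2\<close> and \<open>q = \<bar>1 - \<i> s\<bar>\<^sup>2\<close> have sum \<open>2 R\<close> for
  \<open>R = 1 + \<bar>z\<bar>\<close> by the parallelogram law, so they are \<open>R * (1 \<plusminus> y)\<close>, and \<open>\<bar>1 + z\<bar>\<^sup>2 = p * q = R\<^sup>2 * (1 - y\<^sup>2)\<close>.
  Where \<open>cheb_num l\<close> grows, the factor \<open>1 + z\<close> shrinks, which is why the product exceeds \<open>R ^ t\<close>
  by no more than \<open>exp (2 * l\<^sup>2 / t)\<close>.\<close>
lemma cheb_num_circle_bound:
  fixes z :: complex
  assumes l: "l \<le> t" and t: "0 < t"
  shows "cmod (poly (cheb_num l) z) * cmod (1 + z) ^ (t - l)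
         \<le> (1 + cmod z) ^ t * exp (2 * (real l)\<^sup>2 / real t)"
proof -
  define s where "s = csqrt z"
  have s: "s\<^sup>2 = z" by (simp add: s_def)
  define p where "p = (cmod (1 + \<i> * s))\<^sup>2"
  define q where "q = (cmod (1 - \<i> * s))\<^sup>2"
  define R where "R = 1 + cmod z"
  have R: "1 \<le> R" by (simp add: R_def)
  have pq: "p + q = 2 * R"
  proof -
    have "p + q = 2 * (1 + (cmod s)\<^sup>2)"
      unfolding p_def q_def cmod_power2 by (simp add: power2_eq_square algebra_simps)
    also have "(cmod s)\<^sup>2 = cmod z" by (simp add: s flip: norm_power)
    finally show ?thesis by (simp add: R_def)
  qed
  define y where "y = \<bar>p / R - 1\<bar>"
  have p0: "0 \<le> p" "0 \<le> q" by (simp_all add: p_def q_def)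
  have y01: "0 \<le> y" "y \<le> 1"
  proof -
    have "p / R \<le> 2" using pq p0 R by (simp add: pos_divide_le_eq)
    moreover have "0 \<le> p / R" using p0 R by simp
    ultimately show "0 \<le> y" "y \<le> 1" by (auto simp: y_def)
  qed
  have p_le: "p \<le> R * (1 + y)" "q \<le> R * (1 + y)"
  proof -
    have "p = R * (1 + (p / R - 1))" using R by simp
    also have "\<dots> \<le> R * (1 + y)" using R by (intro mult_left_mono) (auto simp: y_def)
    finally show "p \<le> R * (1 + y)" .
    have "q = R * (1 - (p / R - 1))" using R pq by (simp add: algebra_simps)
    also have "\<dots> \<le> R * (1 + y)" using R by (intro mult_left_mono) (auto simp: y_def)
    finally show "q \<le> R * (1 + y)" .
  qed
  have pq': "cmod (1 + z) = R * sqrt (1 - y\<^sup>2)"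
  proof -
    have "(1 + \<i> * s) * (1 - \<i> * s) = 1 + z"
      by (simp add: s[symmetric] power2_eq_square algebra_simps)
    then have "(cmod (1 + z))\<^sup>2 = p * q"
      by (metis norm_mult p_def power_mult_distrib q_def)
    also have "p * q = R\<^sup>2 * (1 - y\<^sup>2)"
    proof -
      have q: "q = 2 * R - p" using pq by simp
      have "R\<^sup>2 * (1 - y\<^sup>2) = R\<^sup>2 - (R * (p / R - 1))\<^sup>2"
        unfolding power_mult_distrib by (simp add: y_def right_diff_distrib)
      also have "R * (p / R - 1) = p - R" using R by (simp add: algebra_simps)
      finally show ?thesis by (simp add: q power2_eq_square algebra_simps)
    qed
    finally have "cmod (1 + z) = sqrt (R\<^sup>2 * (1 - y\<^sup>2))"
      by (metis norm_ge_zero real_sqrt_unique)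
    then show ?thesis using R by (simp add: real_sqrt_mult)
  qed
  have "2 * cmod (poly (cheb_num l) z) = cmod ((1 + \<i> * s) ^ (2 * l) + (1 - \<i> * s) ^ (2 * l))"
    using poly_cheb_num_square[of l s] by (metis norm_mult norm_numeral s)
  also have "\<dots> \<le> p ^ l + q ^ l"
    by (rule order_trans[OF norm_triangle_ineq]) (simp add: p_def q_def norm_power power_mult)
  also have "\<dots> \<le> (R * (1 + y)) ^ l + (R * (1 + y)) ^ l"
    using p0 p_le by (intro add_mono power_mono) auto
  finally have "cmod (poly (cheb_num l) z) \<le> (R * (1 + y)) ^ l" by simp
  then have "cmod (poly (cheb_num l) z) * cmod (1 + z) ^ (t - l)
      \<le> (R * (1 + y)) ^ l * (R * sqrt (1 - y\<^sup>2)) ^ (t - l)"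
    unfolding pq' using R y01
    by (intro mult_right_mono zero_le_power mult_nonneg_nonneg) (auto simp: power_le_one)
  also have "\<dots> = (R ^ l * R ^ (t - l)) * ((1 + y) ^ l * sqrt (1 - y\<^sup>2) ^ (t - l))"
    by (simp only: power_mult_distrib mult_ac)
  also have "R ^ l * R ^ (t - l) = R ^ t" using l by (simp flip: power_add)
  also have "R ^ t * ((1 + y) ^ l * sqrt (1 - y\<^sup>2) ^ (t - l)) \<le> R ^ t * exp (2 * (real l)\<^sup>2 / real t)"
    using R by (intro mult_left_mono chebyshev_growth[OF y01 l t]) simp
  finally show ?thesis by (simp add: R_def)
qed

text \<open>The Bernstein coefficients of \<open>cos (l * \<theta>)\<close> in the variable \<open>x = sin(\<theta>/2)\<^sup>2\<close> are those of
  \<open>P = cheb_num l * (1 + z) ^ (t - l)\<close> divided by the binomial coefficients, because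
  \<open>x ^ j * (1 - x) ^ (t - j) = (1 - x) ^ t * z ^ j\<close> for \<open>z = x / (1 - x) = tan(\<theta>/2)\<^sup>2\<close>.\<close>
lemma cos_multiple_bernstein_form:
  assumes l: "l \<le> t" and t: "0 < t"
  shows "\<exists>c. (\<forall>\<theta>. cos (\<theta> / 2) \<noteq> 0 \<longrightarrow>
                cos (real l * \<theta>) = (\<Sum>j\<le>t. c j * bernstein t j ((sin (\<theta> / 2))\<^sup>2))) \<and>
             (\<forall>j\<le>t. \<bar>c j\<bar> \<le> (real t + 1) * exp (2 * (real l)\<^sup>2 / real t))"
proof -
  define P where "P = cheb_num l * [:1, 1:] ^ (t - l)"
  define c where "c j = Re (coeff P j) / real (t choose j)" for j
  have dP: "degree P \<le> t"
  proof -
    have "degree P \<le> degree (cheb_num l) + degree ([:1, 1::complex:] ^ (t - l))"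
      unfolding P_def by (rule degree_mult_le)
    also have "\<dots> \<le> l + (t - l)"
      using degree_cheb_num[of l] degree_power_le[of "[:1, 1::complex:]" "t - l"] by simp
    finally show ?thesis using l by simp
  qed
  have "cos (real l * \<theta>) = (\<Sum>j\<le>t. c j * bernstein t j ((sin (\<theta> / 2))\<^sup>2))"
    if co: "cos (\<theta> / 2) \<noteq> 0" for \<theta>
  proof -
    define A where "A = (cos (\<theta> / 2))\<^sup>2"
    define B where "B = (sin (\<theta> / 2))\<^sup>2"
    have A: "A \<noteq> 0" using co by (simp add: A_def)
    have AB: "A = 1 - B" by (simp add: A_def B_def cos_squared_eq)
    have T: "(tan (\<theta> / 2))\<^sup>2 = B / A" by (simp add: tan_def power_divide A_def B_def)
    have "poly P (of_real (B / A)) * of_real (A ^ t)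
        = (poly (cheb_num l) (of_real (B / A)) * of_real (A ^ l))
          * ((1 + of_real (B / A)) * of_real A) ^ (t - l)"
    proof -
      have "complex_of_real (A ^ t) = of_real (A ^ l) * of_real A ^ (t - l)"
        using l by (simp flip: power_add)
      then show ?thesis by (simp add: P_def power_mult_distrib)
    qed
    also have "(1 + of_real (B / A)) * complex_of_real A = 1"
    proof -
      have "(1 + B / A) * A = 1" using A AB by (simp add: distrib_right)
      then show ?thesis by (metis of_real_1 of_real_add of_real_mult)
    qed
    also have "poly (cheb_num l) (of_real (B / A)) * of_real (A ^ l) = of_real (cos (real l * \<theta>))"
      using poly_cheb_num_tan[OF co, of l] by (simp add: T A_def power_mult)
    finally have "of_real (cos (real l * \<theta>)) = poly P (of_real (B / A)) * of_real (A ^ t)" by simp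
    also have "\<dots> = (\<Sum>j\<le>t. coeff P j * of_real ((B / A) ^ j) * of_real (A ^ t))"
      unfolding sum_distrib_right[symmetric] poly_altdef of_real_power
      by (intro arg_cong2[where f = "(*)"] sum.mono_neutral_left refl)
         (use dP in \<open>auto simp: coeff_eq_0\<close>)
    finally have "cos (real l * \<theta>) = Re (\<Sum>j\<le>t. coeff P j * of_real ((B / A) ^ j) * of_real (A ^ t))"
      by (metis Re_complex_of_real)
    also have "\<dots> = (\<Sum>j\<le>t. Re (coeff P j) * ((B / A) ^ j * A ^ t))"
      by (simp add: mult.assoc flip: of_real_mult of_real_power of_real_divide)
    also have "\<dots> = (\<Sum>j\<le>t. c j * bernstein t j B)"
    proof (intro sum.cong refl)
      fix j assume j: "j \<in> {..t}"
      then have "A ^ t = A ^ j * A ^ (t - j)" by (simp flip: power_add)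
      then have "(B / A) ^ j * A ^ t = B ^ j * (1 - B) ^ (t - j)"
        using A by (simp add: power_divide flip: AB)
      then show "Re (coeff P j) * ((B / A) ^ j * A ^ t) = c j * bernstein t j B"
        using j by (simp add: c_def bernstein_def)
    qed
    finally show ?thesis by (simp add: B_def)
  qed
  moreover have "\<bar>c j\<bar> \<le> (real t + 1) * exp (2 * (real l)\<^sup>2 / real t)" if j: "j \<le> t" for j
  proof -
    define x where "x = (real j + 1 / 2) / (real t + 1)"
    note x = bernstein_mode[OF j, folded x_def]
    \<comment> \<open>On the circle of radius \<open>r\<close> with \<open>r / (1 + r) = x\<close>, Cauchy's estimate compares \<open>coeff P j\<close> with \<open>1 / B\<^sub>j(x)\<close>.\<close>
    define r where "r = x / (1 - x)"
    have r: "0 < r" using x by (simp add: r_def)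
    have r1: "1 + r = 1 / (1 - x)" using x by (simp add: r_def field_simps)
    define E where "E = exp (2 * (real l)\<^sup>2 / real t)"
    have "cmod (coeff P j) * r ^ j \<le> (1 + r) ^ t * E"
    proof (rule coeff_le_max_on_circle)
      fix z :: complex assume "cmod z = r"
      then show "cmod (poly P z) \<le> (1 + r) ^ t * E"
        using cheb_num_circle_bound[OF l t, of z] by (simp add: P_def E_def norm_mult norm_power)
    qed (use r in simp)
    then have "cmod (coeff P j) * r ^ j * (1 - x) ^ t \<le> (1 + r) ^ t * E * (1 - x) ^ t"
      using x by (intro mult_right_mono) simp_all
    also have "\<dots> = E" using x by (simp add: r1 power_divide)
    also have "cmod (coeff P j) * r ^ j * (1 - x) ^ t = cmod (coeff P j) * (x ^ j * (1 - x) ^ (t - j))"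
    proof -
      have "(1 - x) ^ t = (1 - x) ^ j * (1 - x) ^ (t - j)" using j by (simp flip: power_add)
      then show ?thesis using x by (simp add: r_def power_divide)
    qed
    finally have le: "cmod (coeff P j) * (x ^ j * (1 - x) ^ (t - j)) \<le> E" .
    have "real (t choose j) * \<bar>c j\<bar> = \<bar>Re (coeff P j)\<bar>" using j by (simp add: c_def)
    also have "\<dots> \<le> cmod (coeff P j)" by (rule abs_Re_le_cmod)
    finally have "real (t choose j) * \<bar>c j\<bar> * (x ^ j * (1 - x) ^ (t - j)) \<le> E"
      using le x by (meson mult_right_mono mult_nonneg_nonneg order_trans zero_le_power less_imp_le
          diff_ge_0_iff_ge)
    then have "\<bar>c j\<bar> * bernstein t j x \<le> E" by (simp add: bernstein_def mult_ac)
    have "\<bar>c j\<bar> * 1 \<le> \<bar>c j\<bar> * ((real t + 1) * bernstein t j x)"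
      using x by (intro mult_left_mono) simp_all
    also have "\<dots> = (real t + 1) * (\<bar>c j\<bar> * bernstein t j x)" by simp
    also have "\<dots> \<le> (real t + 1) * E"
      using \<open>\<bar>c j\<bar> * bernstein t j x \<le> E\<close> by (intro mult_left_mono) simp_all
    finally show ?thesis by (simp add: E_def)
  qed
  ultimately show ?thesis by blast
qed

section \<open>Jackson's theorem with bounded Bernstein coefficients\<close>

text \<open>The weights \<open>u\<^sub>a\<close>, proportional to \<open>sin (\<pi> * (a + 1) / (m + 2))\<close>, are the top eigenvector of the path with
  \<open>m + 1\<close> vertices; they maximise the first Fourier coefficient of the kernel below.\<close>
lemma ex_sine_weights:
  "\<exists>u :: nat \<Rightarrow> real. (\<Sum>a\<le>m. (u a)\<^sup>2) = 1 \<and>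
     (\<Sum>a<m. u a * u (Suc a)) = cos (pi / (real m + 2))"
proof -
  define h where "h = pi / (real m + 2)"
  define w where "w i = sin (real i * h)" for i :: nat
  have rec: "w i + w (Suc (Suc i)) = 2 * cos h * w (Suc i)" for i
  proof -
    have "real i * h = real (Suc i) * h - h" "real (Suc (Suc i)) * h = real (Suc i) * h + h"
      by (simp_all add: algebra_simps)
    then show ?thesis unfolding w_def by (simp only: sin_add sin_diff) simp
  qed
  have tele: "2 * (\<Sum>a<k. w (Suc a) * w (Suc (Suc a)))
      = 2 * cos h * (\<Sum>a\<le>k. (w (Suc a))\<^sup>2) - w (Suc k) * w (Suc (Suc k))" for k
  proof (induction k)
    case 0
    have "w 0 = 0" by (simp add: w_def)
    with rec[of 0] show ?case by (simp add: power2_eq_square)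
  next
    case (Suc k)
    have "w (Suc (Suc k)) * (w (Suc k) + w (Suc (Suc (Suc k))))
        = w (Suc (Suc k)) * (2 * cos h * w (Suc (Suc k)))"
      by (simp only: rec)
    with Suc show ?case by (simp add: power2_eq_square algebra_simps)
  qed
  have last: "w (Suc (Suc m)) = 0"
  proof -
    have "real (Suc (Suc m)) * h = pi" by (simp add: h_def field_simps)
    then show ?thesis by (simp add: w_def)
  qed
  define V where "V = (\<Sum>a\<le>m. (w (Suc a))\<^sup>2)"
  have "0 < w 1"
    unfolding w_def using sin_gt_zero[of h] by (simp add: h_def divide_less_eq)
  moreover have "(w (Suc 0))\<^sup>2 \<le> V"
    unfolding V_def by (rule member_le_sum) simp_all
  ultimately have V: "0 < V" by (metis One_nat_def less_le_trans zero_less_power)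
  define u where "u a = w (Suc a) / sqrt V" for a
  have "(\<Sum>a\<le>m. (u a)\<^sup>2) = V / V"
    using V by (simp add: u_def power_divide V_def flip: sum_divide_distrib)
  moreover have "(\<Sum>a<m. u a * u (Suc a)) = (\<Sum>a<m. w (Suc a) * w (Suc (Suc a))) / V"
    using V by (simp add: u_def sum_divide_distrib)
  moreover have "(\<Sum>a<m. w (Suc a) * w (Suc (Suc a))) = cos h * V"
    using tele[of m] last by (simp add: V_def)
  ultimately show ?thesis using V by (intro exI[of _ u]) (simp add: h_def)
qed

text \<open>The trigonometric polynomial \<open>\<bar>\<Sum>a\<le>m. u\<^sub>a * exp (\<i> a \<phi>)\<bar>\<^sup>2\<close>, written as a real double sum.\<close>
definition jackson_kernel :: "nat \<Rightarrow> (nat \<Rightarrow> real) \<Rightarrow> real \<Rightarrow> real" where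
  "jackson_kernel m u \<phi> = (\<Sum>a\<le>m. \<Sum>b\<le>m. u a * u b * cos ((real a - real b) * \<phi>))"

lemma jackson_kernel_nonneg: "0 \<le> jackson_kernel m u \<phi>"
proof -
  have "jackson_kernel m u \<phi> = (\<Sum>a\<le>m. u a * cos (real a * \<phi>))\<^sup>2 + (\<Sum>a\<le>m. u a * sin (real a * \<phi>))\<^sup>2"
    by (simp add: jackson_kernel_def power2_eq_square sum_product sum.distrib[symmetric]
        left_diff_distrib cos_diff algebra_simps)
  then show ?thesis by simp
qed

lemma average_jackson_kernel:
  assumes "m < N"
  shows "(\<Sum>s<N. jackson_kernel m u (\<theta> - 2 * pi * of_nat s / of_nat N)) / of_nat N = (\<Sum>a\<le>m. (u a)\<^sup>2)"
proof -
  have "(\<Sum>s<N. jackson_kernel m u (\<theta> - 2 * pi * of_nat s / of_nat N)) / of_nat N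
      = (\<Sum>a\<le>m. \<Sum>b\<le>m. u a * u b *
          ((\<Sum>s<N. cos (of_int (int a - int b) * (\<theta> - 2 * pi * of_nat s / of_nat N))) / of_nat N))"
    unfolding jackson_kernel_def sum_divide_distrib sum_distrib_left
    by (subst sum.swap, rule sum.cong[OF refl], subst sum.swap) simp
  also have "\<dots> = (\<Sum>a\<le>m. \<Sum>b\<le>m. if b = a then (u a)\<^sup>2 else 0)"
  proof (intro sum.cong refl)
    fix a b assume "a \<in> {..m}" "b \<in> {..m}"
    then have "\<bar>int a - int b\<bar> < int N" using assms by auto
    from average_cos_equispaced[OF this]
    show "u a * u b *
          ((\<Sum>s<N. cos (of_int (int a - int b) * (\<theta> - 2 * pi * of_nat s / of_nat N))) / of_nat N)
        = (if b = a then (u a)\<^sup>2 else 0)"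
      by (simp add: power2_eq_square)
  qed
  finally show ?thesis by simp
qed

lemma average_jackson_kernel_cos:
  assumes "m + 1 < N"
  shows "(\<Sum>s<N. jackson_kernel m u (\<theta> - 2 * pi * of_nat s / of_nat N)
            * cos (\<theta> - 2 * pi * of_nat s / of_nat N)) / of_nat N
         = (\<Sum>a<m. u a * u (Suc a))"
proof -
  define x where "x s = \<theta> - 2 * pi * of_nat s / of_nat N" for s :: nat
  define avg where "avg l = (\<Sum>s<N. cos (of_int l * x s)) / of_nat N" for l :: int
  have avg: "avg l = (if l = 0 then 1 else 0)" if "\<bar>l\<bar> < int N" for l
    using average_cos_equispaced[OF that] by (simp add: avg_def x_def)
  have cc: "cos ((real a - real b) * y) * cos y
      = (cos (of_int (int a - int b + 1) * y) + cos (of_int (int a - int b - 1) * y)) / 2" for a b y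
  proof -
    have "of_int (int a - int b + 1) * y = (real a - real b) * y + y"
      "of_int (int a - int b - 1) * y = (real a - real b) * y - y"
      by (simp_all add: algebra_simps)
    then show ?thesis by (simp only: cos_add cos_diff) simp
  qed
  have "(\<Sum>s<N. jackson_kernel m u (x s) * cos (x s)) / of_nat N
      = (\<Sum>a\<le>m. \<Sum>b\<le>m. u a * u b * ((avg (int a - int b + 1) + avg (int a - int b - 1)) / 2))"
  proof -
    have "(\<Sum>s<N. jackson_kernel m u (x s) * cos (x s)) / of_nat N
      = (\<Sum>s<N. \<Sum>a\<le>m. \<Sum>b\<le>m. u a * u b *
          (cos (of_int (int a - int b + 1) * x s) + cos (of_int (int a - int b - 1) * x s)) / 2 / of_nat N)"
      unfolding jackson_kernel_def sum_divide_distrib sum_distrib_right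
      by (intro sum.cong refl) (simp only: mult.assoc cc times_divide_eq_right)
    also have "\<dots> = (\<Sum>a\<le>m. \<Sum>b\<le>m. \<Sum>s<N. u a * u b *
          (cos (of_int (int a - int b + 1) * x s) + cos (of_int (int a - int b - 1) * x s)) / 2 / of_nat N)"
      by (subst sum.swap, rule sum.cong[OF refl], subst sum.swap) simp
    also have "\<dots> = (\<Sum>a\<le>m. \<Sum>b\<le>m. u a * u b * ((avg (int a - int b + 1) + avg (int a - int b - 1)) / 2))"
      unfolding avg_def
      by (intro sum.cong refl)
        (simp add: sum_divide_distrib sum_distrib_left sum.distrib[symmetric] add_divide_distrib
          distrib_left mult.commute[of 2])
    finally show ?thesis .
  qed
  also have "\<dots> = (\<Sum>a\<le>m. \<Sum>b\<le>m. ((if b = Suc a then u a * u b else 0)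
        + (if a = Suc b then u a * u b else 0)) / 2)"
  proof (intro sum.cong refl)
    fix a b assume "a \<in> {..m}" "b \<in> {..m}"
    then have "\<bar>int a - int b + 1\<bar> < int N" "\<bar>int a - int b - 1\<bar> < int N" using assms by auto
    from avg[OF this(1)] avg[OF this(2)]
    show "u a * u b * ((avg (int a - int b + 1) + avg (int a - int b - 1)) / 2)
        = ((if b = Suc a then u a * u b else 0) + (if a = Suc b then u a * u b else 0)) / 2"
      by auto
  qed
  also have "\<dots> = ((\<Sum>a\<le>m. \<Sum>b\<le>m. if b = Suc a then u a * u b else 0)
        + (\<Sum>a\<le>m. \<Sum>b\<le>m. if a = Suc b then u a * u b else 0)) / 2"
    by (simp only: sum_divide_distrib sum.distrib add_divide_distrib)
  also have "(\<Sum>a\<le>m. \<Sum>b\<le>m. if a = Suc b then u a * u b else 0)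
      = (\<Sum>a\<le>m. \<Sum>b\<le>m. if b = Suc a then u a * u b else 0)"
    by (subst sum.swap) (simp add: mult.commute cong: if_cong)
  also have "(\<Sum>a\<le>m. \<Sum>b\<le>m. if b = Suc a then u a * u b else 0)
      = (\<Sum>a\<le>m. if a < m then u a * u (Suc a) else 0)"
    by (intro sum.cong refl) (auto simp: Suc_le_eq)
  also have "\<dots> = (\<Sum>a<m. u a * u (Suc a))"
    by (intro sum.mono_neutral_cong_right) auto
  finally show ?thesis by (simp add: x_def)
qed

text \<open>Averaging against the kernel moves a function that is Lipschitz with respect to
  \<open>\<bar>sin (\<phi> / 2)\<bar>\<close> by at most the square root of the kernel average of \<open>sin(\<phi>/2)\<^sup>2 = (1 - cos \<phi>) / 2\<close>, which
  the sine weights make equal to \<open>sin(\<eta>)\<^sup>2\<close> for \<open>\<eta> = \<pi> / (2 * (m + 2))\<close>.\<close>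
lemma jackson_kernel_average_error:
  fixes F :: "nat \<Rightarrow> real"
  assumes u1: "(\<Sum>a\<le>m. (u a)\<^sup>2) = 1"
    and u2: "(\<Sum>a<m. u a * u (Suc a)) = cos (pi / (real m + 2))"
    and N: "m + 1 < N"
    and F: "\<And>s. s < N \<Longrightarrow> \<bar>F s - c\<bar> \<le> \<bar>sin ((\<theta> - 2 * pi * of_nat s / of_nat N) / 2)\<bar>"
  shows "\<bar>(\<Sum>s<N. F s * jackson_kernel m u (\<theta> - 2 * pi * of_nat s / of_nat N)) / of_nat N - c\<bar>
         \<le> pi / (2 * (real m + 2))"
proof -
  define x where "x s = \<theta> - 2 * pi * of_nat s / of_nat N" for s :: nat
  define K where "K s = jackson_kernel m u (x s) / of_nat N" for s
  define \<eta> where "\<eta> = pi / (2 * (real m + 2))"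
  have \<eta>: "0 < \<eta>" by (simp add: \<eta>_def)
  have K0: "0 \<le> K s" for s by (simp add: K_def jackson_kernel_nonneg)
  have K1: "(\<Sum>s<N. K s) = 1"
    using average_jackson_kernel[of m N u \<theta>] N u1 by (simp add: K_def x_def sum_divide_distrib)
  have K2: "(\<Sum>s<N. K s * (sin (x s / 2))\<^sup>2) \<le> \<eta>\<^sup>2"
  proof -
    have s: "(sin (y / 2))\<^sup>2 = (1 - cos y) / 2" for y :: real
      using cos_double_sin[of "y / 2"] by simp
    have "(\<Sum>s<N. K s * (sin (x s / 2))\<^sup>2) = ((\<Sum>s<N. K s) - (\<Sum>s<N. K s * cos (x s))) / 2"
      by (simp add: s sum_divide_distrib right_diff_distrib diff_divide_distrib sum_subtractf)
    also have "(\<Sum>s<N. K s * cos (x s)) = cos (pi / (real m + 2))"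
      using average_jackson_kernel_cos[OF N, of u \<theta>] u2 by (simp add: K_def x_def sum_divide_distrib)
    also have "((\<Sum>s<N. K s) - cos (pi / (real m + 2))) / 2 = (sin \<eta>)\<^sup>2"
      using s[of "pi / (real m + 2)"] by (simp add: K1 \<eta>_def mult.commute)
    also have "\<dots> \<le> \<eta>\<^sup>2"
      using abs_sin_x_le_abs_x[of \<eta>] by (metis abs_le_square_iff)
    finally show ?thesis .
  qed
  have "\<bar>(\<Sum>s<N. F s * K s) - c\<bar> = \<bar>\<Sum>s<N. (F s - c) * K s\<bar>"
    by (simp add: left_diff_distrib sum_subtractf K1 flip: sum_distrib_left)
  also have "\<dots> \<le> (\<Sum>s<N. \<bar>(F s - c) * K s\<bar>)" by (rule sum_abs)
  also have "\<dots> \<le> (\<Sum>s<N. (K s * (sin (x s / 2))\<^sup>2 / \<eta> + \<eta> * K s) / 2)"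
  proof (rule sum_mono)
    fix s assume "s \<in> {..<N}"
    then have "\<bar>F s - c\<bar> \<le> \<bar>sin (x s / 2)\<bar>" using F by (simp add: x_def)
    also have "\<dots> \<le> ((sin (x s / 2))\<^sup>2 / \<eta> + \<eta>) / 2"
    proof -
      have "0 \<le> (\<bar>sin (x s / 2)\<bar> - \<eta>)\<^sup>2" by simp
      then show ?thesis using \<eta> by (simp add: field_simps power2_eq_square)
    qed
    finally have "\<bar>F s - c\<bar> * K s \<le> ((sin (x s / 2))\<^sup>2 / \<eta> + \<eta>) / 2 * K s"
      by (rule mult_right_mono) (rule K0)
    then show "\<bar>(F s - c) * K s\<bar> \<le> (K s * (sin (x s / 2))\<^sup>2 / \<eta> + \<eta> * K s) / 2"
      unfolding abs_mult using K0[of s] by (simp add: algebra_simps add_divide_distrib)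
  qed
  also have "\<dots> = ((\<Sum>s<N. K s * (sin (x s / 2))\<^sup>2) / \<eta> + \<eta> * (\<Sum>s<N. K s)) / 2"
    by (simp add: sum_divide_distrib sum.distrib sum_distrib_left add_divide_distrib)
  also have "\<dots> \<le> (\<eta>\<^sup>2 / \<eta> + \<eta> * 1) / 2"
    using K2 \<eta> unfolding K1 by (intro divide_right_mono add_mono) simp_all
  also have "\<dots> = \<eta>" using \<eta> by (simp add: power2_eq_square)
  finally show ?thesis by (simp add: K_def x_def \<eta>_def sum_divide_distrib)
qed

lemma half_le_sin:
  fixes x :: real
  assumes "0 \<le> x" "x \<le> pi / 2"
  shows "x / 2 \<le> sin x"
proof -
  have "(\<Sum>i<3. sin_coeff i * x ^ i) = x"
    by (simp add: eval_nat_numeral sin_coeff_def)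
  then have b: "\<bar>sin x - x\<bar> \<le> x ^ 3 / 6"
    using Maclaurin_sin_bound[of x 3] assms by (simp add: eval_nat_numeral field_simps)
  have "x \<le> 1.6" using assms pi_approx by simp
  then have "x\<^sup>2 \<le> 1.6\<^sup>2" using assms by (intro power_mono) auto
  then have "x\<^sup>2 \<le> 3" by (simp add: power2_eq_square)
  then have "x * x\<^sup>2 \<le> x * 3" using assms by (intro mult_left_mono) auto
  then have "x ^ 3 / 6 \<le> x / 2" by (simp add: power3_eq_cube power2_eq_square)
  then show ?thesis using b by linarith
qed

text \<open>Summation by parts around the circle: \<open>cos (l * x\<^sub>s)\<close> is a difference of consecutive values of
  a sine, divided by \<open>2 * sin (l * \<pi> / N)\<close>, and the increments of \<open>g\<close> are of order \<open>1 / N\<close>.\<close>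
lemma fourier_coeff_decay:
  fixes g :: "nat \<Rightarrow> real"
  assumes l: "2 * l \<le> N" and N: "0 < N"
    and g1: "\<And>s. \<bar>g s\<bar> \<le> 1" and per: "g N = g 0"
    and g2: "\<And>s. \<bar>g (Suc s) - g s\<bar> \<le> pi / real N"
  shows "\<bar>(\<Sum>s<N. g s * cos (real l * (2 * pi * real s / real N))) / real N\<bar> \<le> 1 / max 1 (real l)"
proof (cases "l = 0")
  case True
  have "\<bar>\<Sum>s<N. g s\<bar> \<le> (\<Sum>s<N. \<bar>g s\<bar>)" by (rule sum_abs)
  also have "\<dots> \<le> (\<Sum>s<N. 1)" by (rule sum_mono) (rule g1)
  finally show ?thesis using True N by simp
next
  case False
  define h where "h = pi / real N"
  define S where "S s = sin (real l * (2 * real s - 1) * h)" for s :: nat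
  define G where "G = (\<Sum>s<N. g s * cos (real l * (2 * pi * real s / real N)))"
  have cS: "2 * sin (real l * h) * cos (real l * (2 * pi * real s / real N)) = S (Suc s) - S s" for s
  proof -
    have a: "real l * (2 * real (Suc s) - 1) * h = real l * (2 * pi * real s / real N) + real l * h"
      "real l * (2 * real s - 1) * h = real l * (2 * pi * real s / real N) - real l * h"
      by (simp_all add: h_def algebra_simps diff_divide_distrib add_divide_distrib)
    show ?thesis unfolding S_def a by (simp add: sin_add sin_diff)
  qed
  have SN: "S N = S 0"
  proof -
    have "real l * (2 * real N - 1) * h = - (real l * h) + 2 * pi * real l"
      using N by (simp add: h_def field_simps)
    then have "S N = sin (- (real l * h) + 2 * pi * of_int (int l))" by (simp add: S_def)
    also have "\<dots> = sin (- (real l * h))"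
      using sin.plus_of_int[of "- (real l * h)" "int l"] by (simp add: mult_ac)
    finally show ?thesis by (simp add: S_def)
  qed
  have parts: "(\<Sum>s<k. g s * (S (Suc s) - S s))
      = g k * S k - g 0 * S 0 - (\<Sum>s<k. (g (Suc s) - g s) * S (Suc s))" for k
    by (induction k) (simp_all add: algebra_simps)
  have "G * (2 * sin (real l * h)) = (\<Sum>s<N. g s * (S (Suc s) - S s))"
    unfolding G_def sum_distrib_right cS[symmetric] by (intro sum.cong refl) simp
  also have "\<dots> = - (\<Sum>s<N. (g (Suc s) - g s) * S (Suc s))"
    by (simp add: parts per SN)
  finally have "\<bar>G * (2 * sin (real l * h))\<bar> = \<bar>\<Sum>s<N. (g (Suc s) - g s) * S (Suc s)\<bar>" by simp
  also have "\<dots> \<le> (\<Sum>s<N. \<bar>(g (Suc s) - g s) * S (Suc s)\<bar>)" by (rule sum_abs)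
  also have "\<dots> \<le> (\<Sum>s<N. pi / real N * 1)"
    unfolding abs_mult by (intro sum_mono mult_mono g2) (simp_all add: S_def)
  also have "\<dots> = pi" using N by simp
  finally have "\<bar>G\<bar> * (2 * \<bar>sin (real l * h)\<bar>) \<le> pi" by (simp add: abs_mult)
  moreover have "real l * h / 2 \<le> \<bar>sin (real l * h)\<bar>"
  proof -
    have "2 * real l \<le> real N" using l by linarith
    then have "real l * h \<le> pi / 2" using N by (simp add: h_def field_simps)
    from half_le_sin[OF _ this] show ?thesis
      using N by (simp add: h_def)
  qed
  ultimately have "\<bar>G\<bar> * (2 * (real l * h / 2)) \<le> pi"
    by (meson abs_ge_zero mult_left_mono order_trans zero_le_numeral)
  then have "(\<bar>G\<bar> / real N * real l) * pi \<le> 1 * pi" by (simp add: h_def mult_ac)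
  then have "\<bar>G\<bar> / real N * real l \<le> 1" by (rule mult_right_le_imp_le) simp
  then have "\<bar>G\<bar> / real N \<le> 1 / real l"
    using False by (simp add: pos_le_divide_eq)
  moreover have "max 1 (real l) = real l" using False by simp
  ultimately show ?thesis by (simp add: G_def)
qed


lemma sum_inverse_le_ln: "(\<Sum>i\<le>m. 1 / max 1 (real i)) \<le> 2 + ln (max 1 (real m))"
proof (induction m)
  case (Suc m)
  have "1 / real (Suc m) \<le> ln (real (Suc m)) - ln (max 1 (real m))" if "m > 0"
  proof -
    have "ln (real m / real (Suc m)) \<le> real m / real (Suc m) - 1"
      using that by (intro ln_le_minus_one) simp
    also have "\<dots> = - (1 / real (Suc m))" by (simp add: field_simps)
    finally show ?thesis using that by (simp add: ln_div max_def)
  qed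
  with Suc show ?case by (cases "m = 0") (simp_all add: max_def)
qed simp

lemma sum_inverse_distance:
  assumes "a \<le> m"
  shows "(\<Sum>b\<le>m. 1 / max 1 \<bar>real a - real b\<bar>) \<le> 2 * (2 + ln (max 1 (real m)))"
proof -
  let ?f = "\<lambda>i. 1 / max 1 (real i)"
  have "(\<Sum>b\<le>m. 1 / max 1 \<bar>real a - real b\<bar>)
      \<le> (\<Sum>b\<in>{..a} \<union> {a..m}. 1 / max 1 \<bar>real a - real b\<bar>)"
    by (rule sum_mono2) (auto simp: max_def)
  also have "\<dots> \<le> (\<Sum>b\<in>{..a}. 1 / max 1 \<bar>real a - real b\<bar>) + (\<Sum>b\<in>{a..m}. 1 / max 1 \<bar>real a - real b\<bar>)"
    by (subst sum.union_inter[symmetric]) (auto intro!: sum_nonneg)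
  also have "(\<Sum>b\<in>{..a}. 1 / max 1 \<bar>real a - real b\<bar>) = (\<Sum>i\<le>a. ?f i)"
    by (rule sum.reindex_bij_witness[of _ "\<lambda>i. a - i" "\<lambda>b. a - b"]) (auto simp: of_nat_diff)
  also have "(\<Sum>b\<in>{a..m}. 1 / max 1 \<bar>real a - real b\<bar>) = (\<Sum>i\<le>m - a. ?f i)"
    by (rule sum.reindex_bij_witness[of _ "\<lambda>i. a + i" "\<lambda>b. b - a"])
      (use assms in \<open>auto simp: of_nat_diff\<close>)
  also have "(\<Sum>i\<le>a. ?f i) \<le> (\<Sum>i\<le>m. ?f i)"
    by (rule sum_mono2) (use assms in auto)
  also have "(\<Sum>i\<le>m - a. ?f i) \<le> (\<Sum>i\<le>m. ?f i)"
    by (rule sum_mono2) auto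
  finally show ?thesis using sum_inverse_le_ln[of m] by simp
qed

text \<open>Jackson's theorem with control of the Bernstein coefficients.  The logarithm comes from
  summing the bounds \<open>1 / l\<close> of \<open>fourier_coeff_decay\<close>.\<close>
theorem lipschitz_bernstein_approximation:
  fixes f :: "real \<Rightarrow> real"
  assumes f: "1-lipschitz_on {0..1} f"
    and f1: "\<And>x. x \<in> {0..1} \<Longrightarrow> \<bar>f x\<bar> \<le> 1"
    and m: "m \<le> t" and t: "0 < t"
  shows "\<exists>a. (\<forall>x\<in>{0..1}. \<bar>f x - (\<Sum>j\<le>t. a j * bernstein t j x)\<bar> \<le> 2 / (real m + 1)) \<and>
    (\<forall>j\<le>t. \<bar>a j\<bar> \<le> 2 * (2 + ln (max 1 (real m))) * ((real t + 1) * exp (2 * (real m)\<^sup>2 / real t)))"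
proof -
  have lip: "\<bar>f x - f y\<bar> \<le> \<bar>x - y\<bar>" if "x \<in> {0..1}" "y \<in> {0..1}" for x y
    using lipschitz_onD[OF f that] by (simp add: dist_real_def)
  define E where "E = (real t + 1) * exp (2 * (real m)\<^sup>2 / real t)"
  obtain u :: "nat \<Rightarrow> real" where u1: "(\<Sum>a\<le>m. (u a)\<^sup>2) = 1"
    and u2: "(\<Sum>a<m. u a * u (Suc a)) = cos (pi / (real m + 2))"
    using ex_sine_weights by blast
  \<comment> \<open>\<open>N > m + 1\<close> makes the node averages of \<open>cos (l * \<phi>)\<close> exact for all \<open>l\<close> that occur, and \<open>2 * m \<le> N\<close> is needed for the decay.\<close>
  define N where "N = 2 * m + 2"
  define th where "th s = 2 * pi * real s / real N" for s :: nat
  define g where "g s = f ((sin (th s / 2))\<^sup>2)" for s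
  define gh where "gh l = (\<Sum>s<N. g s * cos (real l * th s)) / real N" for l :: nat
  define d where "d a b = nat \<bar>int a - int b\<bar>" for a b :: nat
  have d: "real (d a b) = \<bar>real a - real b\<bar>" for a b by (simp add: d_def)
  have dm: "d a b \<le> m" if "a \<le> m" "b \<le> m" for a b using that by (auto simp: d_def)
  have sq01: "(sin y)\<^sup>2 \<in> {0..1}" for y :: real
    using abs_sin_le_one[of y] by (simp add: abs_square_le_1)
  have sin2: "\<bar>f ((sin (x / 2))\<^sup>2) - f ((sin (y / 2))\<^sup>2)\<bar> \<le> \<bar>sin ((x - y) / 2)\<bar>" for x y
  proof -
    have "(sin (x / 2))\<^sup>2 - (sin (y / 2))\<^sup>2 = sin (x / 2 + y / 2) * sin (x / 2 - y / 2)"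
    proof -
      have c: "(cos z)\<^sup>2 = 1 - (sin z)\<^sup>2" for z :: real by (rule cos_squared_eq)
      have "sin (x / 2 + y / 2) * sin (x / 2 - y / 2)
          = (sin (x / 2))\<^sup>2 * (cos (y / 2))\<^sup>2 - (cos (x / 2))\<^sup>2 * (sin (y / 2))\<^sup>2"
        unfolding sin_add sin_diff by (simp add: power2_eq_square algebra_simps)
      then show ?thesis unfolding c by (simp add: algebra_simps)
    qed
    then have "\<bar>(sin (x / 2))\<^sup>2 - (sin (y / 2))\<^sup>2\<bar> \<le> 1 * \<bar>sin (x / 2 - y / 2)\<bar>"
      by (simp only: abs_mult) (intro mult_right_mono, auto)
    with lip[OF sq01 sq01, of "x / 2" "y / 2"] show ?thesis by (simp add: diff_divide_distrib)
  qed
  have gh: "\<bar>gh l\<bar> \<le> 1 / max 1 (real l)" if "l \<le> m" for l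
    unfolding gh_def th_def
  proof (rule fourier_coeff_decay)
    show "2 * l \<le> N" "0 < N" using that by (simp_all add: N_def)
    show "\<bar>g s\<bar> \<le> 1" for s unfolding g_def by (intro f1 sq01)
    have "th N / 2 = pi" by (simp add: th_def N_def)
    then show "g N = g 0" by (simp add: g_def th_def)
    show "\<bar>g (Suc s) - g s\<bar> \<le> pi / real N" for s
    proof -
      have "(th (Suc s) - th s) / 2 = pi / real N"
        by (simp add: th_def add_divide_distrib algebra_simps)
      with sin2[of "th (Suc s)" "th s"] have "\<bar>g (Suc s) - g s\<bar> \<le> \<bar>sin (pi / real N)\<bar>"
        by (simp add: g_def)
      also have "\<dots> \<le> \<bar>pi / real N\<bar>" by (rule abs_sin_x_le_abs_x)
      finally show ?thesis by simp
    qed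
  qed
  \<comment> \<open>Averaging \<open>A \<theta>\<close> and \<open>A (- \<theta>)\<close> removes the sine terms from the approximant.\<close>
  define p where "p \<theta> = (\<Sum>a\<le>m. \<Sum>b\<le>m. u a * u b * gh (d a b) * cos (real (d a b) * \<theta>))" for \<theta>
  define A where "A \<theta> = (\<Sum>s<N. g s * jackson_kernel m u (\<theta> - th s)) / real N" for \<theta>
  have cosd: "cos (real (d a b) * y) = cos ((real a - real b) * y)" for a b y
    unfolding d by (cases "0 \<le> real a - real b") (simp_all only: abs_of_nonneg abs_of_neg
      not_le mult_minus_left cos_minus)
  have pA: "p \<theta> = (A \<theta> + A (- \<theta>)) / 2" for \<theta>
  proof -
    have kk: "cos (k * (\<theta> - x)) + cos (k * (- \<theta> - x)) = 2 * (cos (k * x) * cos (k * \<theta>))" for k x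
      by (simp add: right_diff_distrib cos_diff)
    have K: "jackson_kernel m u (\<theta> - x) + jackson_kernel m u (- \<theta> - x)
       = (\<Sum>a\<le>m. \<Sum>b\<le>m. 2 * (u a * u b * (cos (real (d a b) * x) * cos (real (d a b) * \<theta>))))" for x
      unfolding jackson_kernel_def cosd sum.distrib[symmetric]
      by (intro sum.cong refl) (simp only: distrib_left[symmetric] kk mult.left_commute)
    have "(A \<theta> + A (- \<theta>)) / 2
        = (\<Sum>s<N. g s * (jackson_kernel m u (\<theta> - th s) + jackson_kernel m u (- \<theta> - th s)) / 2 / real N)"
      by (simp add: A_def sum_divide_distrib sum.distrib[symmetric] distrib_left add_divide_distrib
          mult.commute[of 2])
    also have "\<dots> = (\<Sum>s<N. \<Sum>a\<le>m. \<Sum>b\<le>m.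
        u a * u b * (g s * cos (real (d a b) * th s) / real N) * cos (real (d a b) * \<theta>))"
      unfolding K sum_distrib_left sum_divide_distrib by (intro sum.cong refl) simp
    also have "\<dots> = (\<Sum>a\<le>m. \<Sum>b\<le>m. \<Sum>s<N.
        u a * u b * (g s * cos (real (d a b) * th s) / real N) * cos (real (d a b) * \<theta>))"
      by (subst sum.swap, rule sum.cong[OF refl], subst sum.swap) simp
    also have "\<dots> = p \<theta>"
      by (simp add: p_def gh_def sum_distrib_left sum_distrib_right sum_divide_distrib)
    finally show ?thesis ..
  qed
  have err: "\<bar>p \<theta> - f ((sin (\<theta> / 2))\<^sup>2)\<bar> \<le> 2 / (real m + 1)" for \<theta>
  proof -
    have e: "\<bar>A \<phi> - f ((sin (\<phi> / 2))\<^sup>2)\<bar> \<le> pi / (2 * (real m + 2))" for \<phi>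
      unfolding A_def th_def
    proof (rule jackson_kernel_average_error[OF u1 u2])
      show "m + 1 < N" by (simp add: N_def)
      show "\<bar>g s - f ((sin (\<phi> / 2))\<^sup>2)\<bar> \<le> \<bar>sin ((\<phi> - 2 * pi * real s / real N) / 2)\<bar>" for s
        using sin2[of \<phi> "th s"] by (simp add: g_def th_def abs_minus_commute)
    qed
    have "\<bar>p \<theta> - f ((sin (\<theta> / 2))\<^sup>2)\<bar> \<le> pi / (2 * (real m + 2))"
    proof -
      have "\<bar>A (- \<theta>) - f ((sin (\<theta> / 2))\<^sup>2)\<bar> \<le> pi / (2 * (real m + 2))"
        using e[of "- \<theta>"] by simp
      moreover have "\<bar>(X + Y) / 2 - Z\<bar> \<le> r" if "\<bar>X - Z\<bar> \<le> r" "\<bar>Y - Z\<bar> \<le> r" for X Y Z r :: real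
        using that by (simp add: abs_le_iff field_simps)
      ultimately show ?thesis unfolding pA using e[of \<theta>] by blast
    qed
    also have "\<dots> \<le> 4 / (2 * (real m + 1))"
      using pi_less_4 by (intro frac_le) auto
    also have "\<dots> = 2 / (real m + 1)" by (simp add: field_simps)
    finally show ?thesis .
  qed
  define P where "P l c \<longleftrightarrow> (\<forall>\<theta>. cos (\<theta> / 2) \<noteq> 0 \<longrightarrow>
                cos (real l * \<theta>) = (\<Sum>j\<le>t. c j * bernstein t j ((sin (\<theta> / 2))\<^sup>2))) \<and>
             (\<forall>j\<le>t. \<bar>c j\<bar> \<le> (real t + 1) * exp (2 * (real l)\<^sup>2 / real t))" for l c
  have "\<exists>c. P l c" if "l \<le> m" for l
    using cos_multiple_bernstein_form[OF _ t, of l] that m by (simp add: P_def)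
  then obtain c where P: "\<And>l. l \<le> m \<Longrightarrow> P l (c l)" by metis
  have c: "cos (real l * \<theta>) = (\<Sum>j\<le>t. c l j * bernstein t j ((sin (\<theta> / 2))\<^sup>2))"
    if "l \<le> m" "cos (\<theta> / 2) \<noteq> 0" for l \<theta>
    using P[OF that(1)] that(2) by (simp add: P_def)
  have cb: "\<bar>c l j\<bar> \<le> (real t + 1) * exp (2 * (real l)\<^sup>2 / real t)" if "l \<le> m" "j \<le> t" for l j
    using P[OF that(1)] that(2) by (simp add: P_def)
  define al where "al j = (\<Sum>a\<le>m. \<Sum>b\<le>m. u a * u b * gh (d a b) * c (d a b) j)" for j
  have al: "(\<Sum>j\<le>t. al j * bernstein t j ((sin (\<theta> / 2))\<^sup>2)) = p \<theta>" if "cos (\<theta> / 2) \<noteq> 0" for \<theta>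
  proof -
    let ?B = "\<lambda>j. bernstein t j ((sin (\<theta> / 2))\<^sup>2)"
    have "(\<Sum>j\<le>t. al j * ?B j)
        = (\<Sum>j\<le>t. \<Sum>a\<le>m. \<Sum>b\<le>m. u a * u b * gh (d a b) * (c (d a b) j * ?B j))"
      by (simp add: al_def sum_distrib_right mult.assoc)
    also have "\<dots> = (\<Sum>a\<le>m. \<Sum>b\<le>m. \<Sum>j\<le>t. u a * u b * gh (d a b) * (c (d a b) j * ?B j))"
      by (subst sum.swap, rule sum.cong[OF refl], subst sum.swap) simp
    also have "\<dots> = p \<theta>"
      unfolding p_def
      by (intro sum.cong refl) (simp add: c[OF dm that] sum_distrib_left)
    finally show ?thesis .
  qed
  have err': "\<bar>f x - (\<Sum>j\<le>t. al j * bernstein t j x)\<bar> \<le> 2 / (real m + 1)" if x: "x \<in> {0..<1}" for x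
  proof -
    define \<theta> where "\<theta> = 2 * arcsin (sqrt x)"
    have "sqrt x \<in> {-1..1}" using x by (auto intro: order_trans[OF _ real_sqrt_ge_zero])
    then have s: "(sin (\<theta> / 2))\<^sup>2 = x" using x by (simp add: \<theta>_def)
    then have "(cos (\<theta> / 2))\<^sup>2 \<noteq> 0" using x by (simp add: cos_squared_eq)
    then have "cos (\<theta> / 2) \<noteq> 0" by simp
    from al[OF this] err[of \<theta>] show ?thesis by (simp add: s abs_minus_commute)
  qed
  \<comment> \<open>At \<open>x = 1\<close>, where \<open>cos (\<theta> / 2) = 0\<close>, the bound follows by continuity.\<close>
  have "\<bar>f x - (\<Sum>j\<le>t. al j * bernstein t j x)\<bar> \<le> 2 / (real m + 1)" if x: "x \<in> {0..1}" for x
  proof (rule continuous_le_on_closure[where S = "{0..<1}" and x = x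
        and f = "\<lambda>x. \<bar>f x - (\<Sum>j\<le>t. al j * bernstein t j x)\<bar>"])
    have "continuous_on {0..1} f"
      using f by (rule lipschitz_on_continuous_on)
    moreover have "closure {0..<1::real} = {0..1}" by simp
    ultimately show "continuous_on (closure {0..<1}) (\<lambda>x. \<bar>f x - (\<Sum>j\<le>t. al j * bernstein t j x)\<bar>)"
      by (auto simp: bernstein_def intro!: continuous_intros)
    show "x \<in> closure {0..<1}" using x by simp
    show "\<bar>f y - (\<Sum>j\<le>t. al j * bernstein t j y)\<bar> \<le> 2 / (real m + 1)" if "y \<in> {0..<1}" for y
      using err'[OF that] .
  qed
  moreover have "\<bar>al j\<bar> \<le> 2 * (2 + ln (max 1 (real m))) * E" if j: "j \<le> t" for j
  proof -
    have E: "0 \<le> E" by (simp add: E_def)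
    have cE: "\<bar>c l j\<bar> \<le> E" if "l \<le> m" for l
    proof -
      have "2 * (real l)\<^sup>2 / real t \<le> 2 * (real m)\<^sup>2 / real t"
        using that by (intro divide_right_mono mult_left_mono power_mono) simp_all
      then have "(real t + 1) * exp (2 * (real l)\<^sup>2 / real t) \<le> E"
        unfolding E_def by (intro mult_left_mono) simp_all
      then show ?thesis using cb[OF that j] by linarith
    qed
    let ?w = "\<lambda>a b. 1 / max 1 \<bar>real a - real b\<bar>"
    have "\<bar>al j\<bar> \<le> (\<Sum>a\<le>m. \<Sum>b\<le>m. \<bar>u a * u b * gh (d a b) * c (d a b) j\<bar>)"
      unfolding al_def by (rule order_trans[OF sum_abs]) (intro sum_mono sum_abs)
    also have "\<dots> \<le> (\<Sum>a\<le>m. \<Sum>b\<le>m. (((u a)\<^sup>2 + (u b)\<^sup>2) / 2) * ?w a b * E)"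
    proof (intro sum_mono)
      fix a b assume "a \<in> {..m}" "b \<in> {..m}"
      then have ab: "d a b \<le> m" by (simp add: dm)
      have "\<bar>u a * u b\<bar> \<le> ((u a)\<^sup>2 + (u b)\<^sup>2) / 2"
        using sum_squares_bound[of "\<bar>u a\<bar>" "\<bar>u b\<bar>"] by (simp add: abs_mult)
      then show "\<bar>u a * u b * gh (d a b) * c (d a b) j\<bar> \<le> (((u a)\<^sup>2 + (u b)\<^sup>2) / 2) * ?w a b * E"
        unfolding abs_mult[of _ "c (d a b) j"] abs_mult[of _ "gh (d a b)"]
        using gh[OF ab] cE[OF ab] by (intro mult_mono) (auto simp: d)
    qed
    also have "\<dots> = ((\<Sum>a\<le>m. \<Sum>b\<le>m. (u a)\<^sup>2 * ?w a b) + (\<Sum>a\<le>m. \<Sum>b\<le>m. (u b)\<^sup>2 * ?w a b)) / 2 * E"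
      unfolding sum_divide_distrib sum_distrib_right sum.distrib[symmetric]
      by (intro sum.cong refl) (simp add: algebra_simps add_divide_distrib)
    also have "(\<Sum>a\<le>m. \<Sum>b\<le>m. (u b)\<^sup>2 * ?w a b) = (\<Sum>a\<le>m. \<Sum>b\<le>m. (u a)\<^sup>2 * ?w a b)"
      by (subst sum.swap) (simp add: abs_minus_commute)
    also have "((\<Sum>a\<le>m. \<Sum>b\<le>m. (u a)\<^sup>2 * ?w a b) + (\<Sum>a\<le>m. \<Sum>b\<le>m. (u a)\<^sup>2 * ?w a b)) / 2 * E
        = (\<Sum>a\<le>m. (u a)\<^sup>2 * (\<Sum>b\<le>m. ?w a b)) * E"
    proof -
      have "(X + X) / 2 = X" for X :: real by simp
      then show ?thesis by (simp only: sum_distrib_left)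
    qed
    also have "\<dots> \<le> (\<Sum>a\<le>m. (u a)\<^sup>2 * (2 * (2 + ln (max 1 (real m))))) * E"
      by (intro mult_right_mono[OF _ E] sum_mono mult_left_mono sum_inverse_distance) auto
    also have "\<dots> = 2 * (2 + ln (max 1 (real m))) * E"
      by (simp only: sum_distrib_right[symmetric] u1 mult_1)
    finally show ?thesis .
  qed
  ultimately show ?thesis unfolding E_def by blast
qed

section \<open>Duality for the Wasserstein distance\<close>

lemma space_dists01:
  assumes "\<pi> \<in> dists01"
  shows "space \<pi> = {0..1}"
proof -
  have "sets \<pi> = sets (restrict_space borel {0..1})" using assms by (simp add: dists01_def)
  from sets_eq_imp_space_eq[OF this] show ?thesis by (simp add: space_restrict_space)
qed

text \<open>Half of the Kantorovich-Rubinstein duality on the unit interval.  Let \<open>M.I\<close> and \<open>L.I\<close> be the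
  quantile functions of \<open>\<pi>\<close> and \<open>\<rho>\<close>, and let \<open>f\<close> be the integral of \<open>sgn (cdf L - cdf M)\<close>.  Between the two
  quantiles of the same level \<open>\<omega>\<close> the difference of the distribution functions does not change sign,
  so that \<open>f (M.I \<omega>) - f (L.I \<omega>) = \<bar>M.I \<omega> - L.I \<omega>\<bar>\<close> for every \<open>\<omega>\<close>; the quantile coupling therefore costs
  exactly \<open>\<integral>f d\<pi> - \<integral>f d\<rho>\<close>.\<close>
lemma W1_le_dual:
  assumes "\<pi> \<in> dists01" "\<rho> \<in> dists01"
  shows "\<exists>f :: real \<Rightarrow> real. 1-lipschitz_on {0..1} f \<and> (\<forall>x\<in>{0..1}. \<bar>f x\<bar> \<le> 1) \<and>
           W1 \<pi> \<rho> \<le> (\<integral>x. f x \<partial>\<pi>) - (\<integral>x. f x \<partial>\<rho>)"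
proof -
  interpret p: prob_space \<pi> using assms by (simp add: dists01_def)
  interpret r: prob_space \<rho> using assms by (simp add: dists01_def)
  have sp: "sets \<pi> = sets (restrict_space borel {0..1})" "sets \<rho> = sets (restrict_space borel {0..1})"
    using assms by (simp_all add: dists01_def)
  have spc: "space \<pi> = {0..1}" "space \<rho> = {0..1}"
    using assms by (simp_all add: space_dists01)
  have id: "(\<lambda>x. x) \<in> borel_measurable \<pi>" "(\<lambda>x. x) \<in> borel_measurable \<rho>"
    using measurable_restrict_space1[OF measurable_ident_sets[OF refl], of borel "{0..1::real}"]
    by (simp_all add: measurable_cong_sets[OF sp(1) refl] measurable_cong_sets[OF sp(2) refl])
  define M where "M = distr \<pi> borel (\<lambda>x. x)"
  define L where "L = distr \<rho> borel (\<lambda>x. x)"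
  interpret M: cdf_distribution M
    unfolding cdf_distribution_def M_def using id by (intro p.real_distribution_distr)
  interpret L: cdf_distribution L
    unfolding cdf_distribution_def L_def using id by (intro r.real_distribution_distr)
  let ?U = "restrict_space lborel {0<..<1::real}"
  interpret U: prob_space ?U
    by (auto simp: space_restrict_space emeasure_restrict_space intro!: prob_spaceI)
  have M01: "cdf M 1 = 1" "x < 0 \<Longrightarrow> cdf M x = 0" for x
  proof -
    have "{..1} \<inter> space \<pi> = space \<pi>" by (auto simp: spc)
    then show "cdf M 1 = 1" by (simp add: cdf_def M_def measure_distr[OF id(1)] p.prob_space)
    assume "x < 0"
    then have "{..x} \<inter> space \<pi> = {}" by (auto simp: spc)
    then show "cdf M x = 0" by (simp add: cdf_def M_def measure_distr[OF id(1)])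
  qed
  have L01: "cdf L 1 = 1" "x < 0 \<Longrightarrow> cdf L x = 0" for x
  proof -
    have "{..1} \<inter> space \<rho> = space \<rho>" by (auto simp: spc)
    then show "cdf L 1 = 1" by (simp add: cdf_def L_def measure_distr[OF id(2)] r.prob_space)
    assume "x < 0"
    then have "{..x} \<inter> space \<rho> = {}" by (auto simp: spc)
    then show "cdf L x = 0" by (simp add: cdf_def L_def measure_distr[OF id(2)])
  qed
  \<comment> \<open>Opaque names for the quantile functions: their definition contains the left-hand side of the Galois connection.\<close>
  define QM where "QM = M.I"
  define QL where "QL = L.I"
  have psM: "\<omega> \<le> cdf M x \<longleftrightarrow> QM \<omega> \<le> x" if "\<omega> \<in> {0<..<1}" for \<omega> x
    unfolding QM_def by (rule M.pseudoinverse) (use that in auto)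
  have psL: "\<omega> \<le> cdf L x \<longleftrightarrow> QL \<omega> \<le> x" if "\<omega> \<in> {0<..<1}" for \<omega> x
    unfolding QL_def by (rule L.pseudoinverse) (use that in auto)
  have MI: "QM \<omega> \<in> {0..1}" if \<omega>: "\<omega> \<in> {0<..<1}" for \<omega>
  proof -
    have "QM \<omega> \<le> 1" using psM[OF \<omega>, of 1] \<omega> M01 by simp
    moreover have "\<not> QM \<omega> < 0" using psM[OF \<omega>, of "QM \<omega>"] M01(2)[of "QM \<omega>"] \<omega> by auto
    ultimately show ?thesis by simp
  qed
  have LI: "QL \<omega> \<in> {0..1}" if \<omega>: "\<omega> \<in> {0<..<1}" for \<omega>
  proof -
    have "QL \<omega> \<le> 1" using psL[OF \<omega>, of 1] \<omega> L01 by simp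
    moreover have "\<not> QL \<omega> < 0" using psL[OF \<omega>, of "QL \<omega>"] L01(2)[of "QL \<omega>"] \<omega> by auto
    ultimately show ?thesis by simp
  qed
  have sU: "sets ?U = sets (restrict_space borel {0<..<1})"
    by (intro sets_restrict_space_cong) simp
  have mI: "QM \<in> borel_measurable ?U" "QL \<in> borel_measurable ?U"
    using M.measurable_CI[folded QM_def] L.measurable_CI[folded QL_def] by (simp_all add: measurable_cong_sets[OF sU refl])
  have mM: "QM \<in> ?U \<rightarrow>\<^sub>M \<pi>"
    unfolding measurable_cong_sets[OF refl sp(1)]
    by (rule measurable_restrict_space2) (use MI mI in \<open>auto simp: space_restrict_space\<close>)
  have mL: "QL \<in> ?U \<rightarrow>\<^sub>M \<rho>"
    unfolding measurable_cong_sets[OF refl sp(2)]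
    by (rule measurable_restrict_space2) (use LI mI in \<open>auto simp: space_restrict_space\<close>)
  have dM: "distr ?U \<pi> QM = \<pi>"
  proof (rule measure_eqI)
    fix A assume "A \<in> sets (distr ?U \<pi> QM)"
    then have A: "A \<in> sets \<pi>" by simp
    then have A': "A \<in> sets borel" "A \<subseteq> {0..1}"
      unfolding sp sets_restrict_space by auto
    have "emeasure (distr ?U \<pi> QM) A = emeasure (distr ?U borel QM) A"
      using A A' mM mI by (simp add: emeasure_distr)
    also have "\<dots> = emeasure \<pi> A"
      using M.distr_I_eq_M[folded QM_def] A A' id spc by (simp add: M_def emeasure_distr Int_absorb2)
    finally show "emeasure (distr ?U \<pi> QM) A = emeasure \<pi> A" .
  qed simp
  have dL: "distr ?U \<rho> QL = \<rho>"
  proof (rule measure_eqI)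
    fix A assume "A \<in> sets (distr ?U \<rho> QL)"
    then have A: "A \<in> sets \<rho>" by simp
    then have A': "A \<in> sets borel" "A \<subseteq> {0..1}"
      unfolding sp sets_restrict_space by auto
    have "emeasure (distr ?U \<rho> QL) A = emeasure (distr ?U borel QL) A"
      using A A' mL mI by (simp add: emeasure_distr)
    also have "\<dots> = emeasure \<rho> A"
      using L.distr_I_eq_M[folded QL_def] A A' id spc by (simp add: L_def emeasure_distr Int_absorb2)
    finally show "emeasure (distr ?U \<rho> QL) A = emeasure \<rho> A" .
  qed simp
  define \<gamma> where "\<gamma> = distr ?U (\<pi> \<Otimes>\<^sub>M \<rho>) (\<lambda>\<omega>. (QM \<omega>, QL \<omega>))"
  have mP: "(\<lambda>\<omega>. (QM \<omega>, QL \<omega>)) \<in> ?U \<rightarrow>\<^sub>M \<pi> \<Otimes>\<^sub>M \<rho>" using mM mL by simp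
  have "\<gamma> \<in> couplings \<pi> \<rho>"
    unfolding couplings_def \<gamma>_def using mP
    by (simp add: U.prob_space_distr distr_distr comp_def dM dL)
  moreover have "bdd_below ((\<lambda>\<gamma>. \<integral>z. \<bar>fst z - snd z\<bar> \<partial>\<gamma>) ` couplings \<pi> \<rho>)"
    by (rule bdd_belowI2[of _ 0]) simp
  ultimately have "W1 \<pi> \<rho> \<le> (\<integral>z. \<bar>fst z - snd z\<bar> \<partial>\<gamma>)"
    unfolding W1_def by (rule cINF_lower[rotated])
  also have "\<dots> = (\<integral>\<omega>. \<bar>QM \<omega> - QL \<omega>\<bar> \<partial>?U)"
  proof -
    have [measurable]: "(\<lambda>z. fst z) \<in> borel_measurable (\<pi> \<Otimes>\<^sub>M \<rho>)"
      by (rule measurable_compose[OF measurable_fst id(1)])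
    have [measurable]: "(\<lambda>z. snd z) \<in> borel_measurable (\<pi> \<Otimes>\<^sub>M \<rho>)"
      by (rule measurable_compose[OF measurable_snd id(2)])
    have "(\<lambda>z. \<bar>fst z - snd z\<bar>) \<in> borel_measurable (\<pi> \<Otimes>\<^sub>M \<rho>)"
      by measurable
    from integral_distr[OF mP this] show ?thesis by (simp add: \<gamma>_def)
  qed
  finally have W: "W1 \<pi> \<rho> \<le> (\<integral>\<omega>. \<bar>QM \<omega> - QL \<omega>\<bar> \<partial>?U)" .
  define s where "s x = sgn (cdf L x - cdf M x)" for x
  have ms: "s \<in> borel_measurable borel"
    unfolding s_def using M.measurable_C L.measurable_C by simp
  have s1: "\<bar>s x\<bar> \<le> 1" for x by (simp add: s_def sgn_real_def)
  define f where "f x = (\<integral>y. s y * indicator {0..<x} y \<partial>lborel)" for x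
  have ind: "integrable lborel (indicator {a..<b} :: real \<Rightarrow> real)" for a b :: real
    by (cases "a \<le> b") simp_all
  have int: "integrable lborel (\<lambda>y. s y * indicator {a..<b} y)" for a b
  proof (rule Bochner_Integration.integrable_bound[OF ind])
    show "AE y in lborel. norm (s y * indicator {a..<b} y) \<le> norm (indicator {a..<b} y :: real)"
      using s1 by (auto simp: indicator_def)
  qed (use ms in simp)
  have fd: "f b - f a = (\<integral>y. s y * indicator {a..<b} y \<partial>lborel)" if "0 \<le> a" "a \<le> b" for a b
  proof -
    have "f b - f a = (\<integral>y. s y * indicator {0..<b} y - s y * indicator {0..<a} y \<partial>lborel)"
      unfolding f_def by (rule Bochner_Integration.integral_diff[symmetric]) (rule int)+
    also have "\<dots> = (\<integral>y. s y * indicator {a..<b} y \<partial>lborel)"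
      using that by (intro Bochner_Integration.integral_cong refl) (auto simp: indicator_def)
    finally show ?thesis .
  qed
  have fl: "\<bar>f b - f a\<bar> \<le> b - a" if "0 \<le> a" "a \<le> b" for a b
  proof -
    have "\<bar>f b - f a\<bar> \<le> (\<integral>y. \<bar>s y * indicator {a..<b} y\<bar> \<partial>lborel)"
      unfolding fd[OF that] by (rule integral_abs_bound)
    also have "\<dots> \<le> (\<integral>y. indicator {a..<b} y \<partial>lborel)"
      by (rule integral_mono[OF integrable_abs[OF int] ind]) (use s1 in \<open>auto simp: indicator_def\<close>)
    also have "\<dots> = b - a" using that by simp
    finally show ?thesis .
  qed
  have lip: "1-lipschitz_on {0..1} f"
  proof (rule lipschitz_onI)
    fix x y :: real assume "x \<in> {0..1}" "y \<in> {0..1}"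
    then show "dist (f x) (f y) \<le> 1 * dist x y"
      using fl[of x y] fl[of y x] by (cases "x \<le> y") (auto simp: dist_real_def abs_minus_commute)
  qed simp
  have f0: "f 0 = 0" by (simp add: f_def)
  have f1: "\<forall>x\<in>{0..1}. \<bar>f x\<bar> \<le> 1"
    using fl[of 0] by (fastforce simp: f0)
  have cont: "continuous_on {0..1} f" using lip by (rule lipschitz_on_continuous_on)
  have mf: "f \<in> borel_measurable \<pi>" "f \<in> borel_measurable \<rho>"
    using borel_measurable_continuous_on_restrict[OF cont]
    by (simp_all add: measurable_cong_sets[OF sp(1) refl] measurable_cong_sets[OF sp(2) refl])
  have key: "f (QM \<omega>) - f (QL \<omega>) = \<bar>QM \<omega> - QL \<omega>\<bar>" if \<omega>: "\<omega> \<in> {0<..<1}" for \<omega>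
  proof -
    show ?thesis
    proof (cases "QL \<omega> \<le> QM \<omega>")
      case True
      have "s y = 1" if "y \<in> {QL \<omega>..<QM \<omega>}" for y
        using that psM[OF \<omega>, of y] psL[OF \<omega>, of y] by (auto simp: s_def sgn_real_def)
      then have "f (QM \<omega>) - f (QL \<omega>) = (\<integral>y. indicator {QL \<omega>..<QM \<omega>} y \<partial>lborel)"
        using fd[OF _ True] LI[OF \<omega>]
        by (auto intro!: Bochner_Integration.integral_cong simp: indicator_def)
      then show ?thesis using True by simp
    next
      case False
      then have le: "QM \<omega> \<le> QL \<omega>" by simp
      have MI0: "0 \<le> QM \<omega>" using MI[OF \<omega>] by simp
      have "s y = -1" if "y \<in> {QM \<omega>..<QL \<omega>}" for y
        using that psM[OF \<omega>, of y] psL[OF \<omega>, of y] by (auto simp: s_def sgn_real_def)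
      then have "f (QL \<omega>) - f (QM \<omega>) = (\<integral>y. - indicator {QM \<omega>..<QL \<omega>} y \<partial>lborel)"
        unfolding fd[OF MI0 le] by (intro Bochner_Integration.integral_cong refl) (auto simp: indicator_def)
      then show ?thesis using le by simp
    qed
  qed
  have intf: "integrable ?U (\<lambda>\<omega>. f (QM \<omega>))" "integrable ?U (\<lambda>\<omega>. f (QL \<omega>))"
  proof -
    have "(\<lambda>\<omega>. f (QM \<omega>)) \<in> borel_measurable ?U" "(\<lambda>\<omega>. f (QL \<omega>)) \<in> borel_measurable ?U"
      using measurable_compose[OF mM mf(1)] measurable_compose[OF mL mf(2)] by simp_all
    then show "integrable ?U (\<lambda>\<omega>. f (QM \<omega>))" "integrable ?U (\<lambda>\<omega>. f (QL \<omega>))"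
      using f1 MI LI
      by (auto intro!: U.integrable_const_bound[where B = 1] simp: space_restrict_space)
  qed
  have "(\<integral>\<omega>. \<bar>QM \<omega> - QL \<omega>\<bar> \<partial>?U) = (\<integral>\<omega>. f (QM \<omega>) - f (QL \<omega>) \<partial>?U)"
    using key by (intro Bochner_Integration.integral_cong refl) (simp add: space_restrict_space)
  also have "\<dots> = (\<integral>\<omega>. f (QM \<omega>) \<partial>?U) - (\<integral>\<omega>. f (QL \<omega>) \<partial>?U)"
    using intf by simp
  also have "(\<integral>\<omega>. f (QM \<omega>) \<partial>?U) = (\<integral>x. f x \<partial>\<pi>)"
    using integral_distr[OF mM mf(1)] by (simp add: dM)
  also have "(\<integral>\<omega>. f (QL \<omega>) \<partial>?U) = (\<integral>x. f x \<partial>\<rho>)"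
    using integral_distr[OF mL mf(2)] by (simp add: dL)
  finally show ?thesis using W lip f1 by auto
qed

section \<open>Frequencies, quantiles and errors of the test\<close>

lemma integral_sum_bernstein:
  assumes \<pi>: "\<pi> \<in> dists01"
  shows "integrable \<pi> (bernstein t j)"
    and "b_coef j t \<pi> = (\<integral>x. bernstein t j x \<partial>\<pi>)"
    and "(\<integral>x. (\<Sum>j\<le>t. a j * bernstein t j x) \<partial>\<pi>) = (\<Sum>j\<le>t. a j * b_coef j t \<pi>)"
proof -
  interpret prob_space \<pi> using \<pi> by (simp add: dists01_def)
  have sp: "sets \<pi> = sets (restrict_space borel {0..1})" using \<pi> by (simp add: dists01_def)
  have spc: "space \<pi> = {0..1}" by (rule space_dists01[OF \<pi>])
  show int: "integrable \<pi> (bernstein t j)" for j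
  proof (rule integrable_const_bound[where B = 1])
    have "bernstein t j \<in> borel_measurable borel"
      unfolding bernstein_def by measurable
    then show "bernstein t j \<in> borel_measurable \<pi>"
      unfolding measurable_cong_sets[OF sp refl] by (rule measurable_restrict_space1)
    have "\<bar>bernstein t j x\<bar> \<le> 1" if "x \<in> {0..1}" for x
    proof (cases "j \<le> t")
      case True
      have "bernstein t j x \<le> (\<Sum>i\<le>t. bernstein t i x)"
        using True that by (intro member_le_sum) (auto intro: bernstein_nonneg)
      then show ?thesis using bernstein_nonneg[OF that, of t j] by (simp add: sum_bernstein)
    qed (simp add: bernstein_def binomial_eq_0)
    then show "AE x in \<pi>. norm (bernstein t j x) \<le> 1" by (intro AE_I2) (simp add: spc)
  qed
  show b: "b_coef j t \<pi> = (\<integral>x. bernstein t j x \<partial>\<pi>)" for j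
    by (simp add: b_coef_def bernstein_def)
  show "(\<integral>x. (\<Sum>j\<le>t. a j * bernstein t j x) \<partial>\<pi>) = (\<Sum>j\<le>t. a j * b_coef j t \<pi>)"
    using int by (simp add: b)
qed

lemma b_coef_nonneg:
  assumes \<pi>: "\<pi> \<in> dists01"
  shows "0 \<le> b_coef j t \<pi>"
  unfolding integral_sum_bernstein(2)[OF \<pi>]
  by (rule Bochner_Integration.integral_nonneg) (simp add: bernstein_nonneg space_dists01[OF \<pi>])

lemma sum_b_coef:
  assumes \<pi>: "\<pi> \<in> dists01"
  shows "(\<Sum>j\<le>t. b_coef j t \<pi>) = 1"
proof -
  interpret prob_space \<pi> using \<pi> by (simp add: dists01_def)
  show ?thesis
    using integral_sum_bernstein(3)[OF \<pi>, where a = "\<lambda>_. 1" and t = t] by (simp add: sum_bernstein prob_space)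
qed

lemma b_coef_le_1:
  assumes "\<pi> \<in> dists01" "j \<le> t"
  shows "b_coef j t \<pi> \<le> 1"
  unfolding sum_b_coef[OF assms(1), of t, symmetric]
  using assms by (intro member_le_sum) (auto simp: b_coef_nonneg)

lemma mixture_facts:
  assumes \<pi>: "\<pi> \<in> dists01"
  shows "prob_space (mixture t \<pi>)"
    and "space (mixture t \<pi>) = {..t}"
    and "integrable (mixture t \<pi>) (g :: nat \<Rightarrow> real)"
    and "(\<integral>x. g x \<partial>mixture t \<pi>) = (\<Sum>j\<le>t. b_coef j t \<pi> * g j)"
proof -
  show "prob_space (mixture t \<pi>)"
    unfolding mixture_def
    using sum_b_coef[OF \<pi>, of t] by (intro prob_space_point_measure) (auto simp: b_coef_nonneg[OF \<pi>] atLeast0AtMost)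
  show "space (mixture t \<pi>) = {..t}"
    by (simp add: mixture_def space_point_measure atLeast0AtMost)
  show "integrable (mixture t \<pi>) g"
    unfolding mixture_def by (intro integrable_point_measure_finite) simp
  show "(\<integral>x. g x \<partial>mixture t \<pi>) = (\<Sum>j\<le>t. b_coef j t \<pi> * g j)"
    unfolding mixture_def
    by (subst lebesgue_integral_point_measure_finite) (auto simp: b_coef_nonneg[OF \<pi>] atLeast0AtMost)
qed

lemma prob_space_iid: "\<pi> \<in> dists01 \<Longrightarrow> prob_space (iid n (mixture t \<pi>))"
  unfolding iid_def by (intro prob_space_PiM mixture_facts)

lemma space_iid: "\<pi> \<in> dists01 \<Longrightarrow> space (iid n (mixture t \<pi>)) = (\<Pi>\<^sub>E i\<in>{1..n}. {..t})"
  by (simp add: iid_def space_PiM mixture_facts)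

lemma sum_count_eq:
  assumes "x \<in> (\<Pi>\<^sub>E i\<in>{1..n}. {..t})"
  shows "(\<Sum>j\<le>t. count_eq n x j) = n"
proof -
  have "(\<Sum>j\<le>t. count_eq n x j) = (\<Sum>i=1..n. \<Sum>j\<le>t. of_bool (x i = j))"
    unfolding count_eq_def by (rule sum.swap)
  also have "\<dots> = (\<Sum>i=1..n. 1)"
  proof (intro sum.cong refl)
    fix i assume i: "i \<in> {1..n}"
    have "x i \<le> t" using PiE_mem[OF assms i] by simp
    then show "(\<Sum>j\<le>t. of_bool (x i = j)) = (1::nat)" by (simp add: of_bool_def)
  qed
  finally show ?thesis by simp
qed

lemma measurable_count_eq [measurable]:
  "(\<lambda>x. real (count_eq n x j)) \<in> borel_measurable (iid n (mixture t \<pi>))"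
proof -
  have eq: "(\<lambda>x. real (count_eq n x j)) = (\<lambda>x. \<Sum>i\<in>{1..n}. of_bool (x i = j))"
    by (simp add: count_eq_def fun_eq_iff)
  have "(\<lambda>x. of_bool (x i = j) :: real) \<in> borel_measurable (iid n (mixture t \<pi>))"
    if "i \<in> {1..n}" for i
    unfolding iid_def
    by (rule measurable_compose[OF measurable_component_singleton[OF that]]) (simp add: mixture_def)
  then show ?thesis unfolding eq by (rule borel_measurable_sum)
qed

text \<open>Independence of the coordinates, for products of one function at two of them.\<close>
lemma integral_product_pair:
  fixes \<phi> :: "nat \<Rightarrow> real"
  assumes \<pi>: "\<pi> \<in> dists01" and ik: "i \<in> {1..n}" "k \<in> {1..n}"
  shows "integrable (iid n (mixture t \<pi>)) (\<lambda>x. \<phi> (x i) * \<phi> (x k))"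
    and "(\<integral>x. \<phi> (x i) * \<phi> (x k) \<partial>iid n (mixture t \<pi>)) =
      (if i = k then (\<Sum>j\<le>t. b_coef j t \<pi> * (\<phi> j)\<^sup>2) else (\<Sum>j\<le>t. b_coef j t \<pi> * \<phi> j)\<^sup>2)"
proof -
  interpret P: prob_space "mixture t \<pi>" by (rule mixture_facts[OF \<pi>])
  interpret product_sigma_finite "\<lambda>_::nat. mixture t \<pi>" by unfold_locales
  define g where "g l y = (if l = i then \<phi> y else 1) * (if l = k then \<phi> y else 1)" for l :: nat and y
  have eq: "\<phi> (x i) * \<phi> (x k) = (\<Prod>l\<in>{1..n}. g l (x l))" for x
    using ik by (simp add: g_def prod.distrib prod.delta)
  have int: "integrable (mixture t \<pi>) (g l)" for l
    by (rule mixture_facts[OF \<pi>])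
  show "integrable (iid n (mixture t \<pi>)) (\<lambda>x. \<phi> (x i) * \<phi> (x k))"
    unfolding eq iid_def using int by (intro product_integrable_prod) auto
  have "(\<integral>x. \<phi> (x i) * \<phi> (x k) \<partial>iid n (mixture t \<pi>)) = (\<Prod>l\<in>{1..n}. \<integral>y. g l y \<partial>mixture t \<pi>)"
    unfolding eq iid_def using int by (intro product_integral_prod) auto
  also have "\<dots> = (\<Prod>l\<in>{1..n}. if i = k then (if l = i then \<integral>y. (\<phi> y)\<^sup>2 \<partial>mixture t \<pi> else 1)
      else (if l = i then \<integral>y. \<phi> y \<partial>mixture t \<pi> else 1) * (if l = k then \<integral>y. \<phi> y \<partial>mixture t \<pi> else 1))"
    by (intro prod.cong refl) (auto simp: g_def power2_eq_square P.prob_space)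
  also have "\<dots> = (if i = k then \<integral>y. (\<phi> y)\<^sup>2 \<partial>mixture t \<pi> else (\<integral>y. \<phi> y \<partial>mixture t \<pi>)\<^sup>2)"
    using ik by (simp add: prod.distrib prod.delta power2_eq_square)
  finally show "(\<integral>x. \<phi> (x i) * \<phi> (x k) \<partial>iid n (mixture t \<pi>)) =
      (if i = k then (\<Sum>j\<le>t. b_coef j t \<pi> * (\<phi> j)\<^sup>2) else (\<Sum>j\<le>t. b_coef j t \<pi> * \<phi> j)\<^sup>2)"
    by (simp add: mixture_facts(4)[OF \<pi>])
qed

lemma variance_frequency:
  assumes \<pi>: "\<pi> \<in> dists01" and j: "j \<le> t" and n: "0 < n"
  shows "integrable (iid n (mixture t \<pi>)) (\<lambda>x. (real (count_eq n x j) / real n - b_coef j t \<pi>)\<^sup>2)"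
    and "(\<integral>x. (real (count_eq n x j) / real n - b_coef j t \<pi>)\<^sup>2 \<partial>iid n (mixture t \<pi>))
          = mu (b_coef j t \<pi>) / real n"
proof -
  define b where "b = b_coef j t \<pi>"
  define \<phi> where "\<phi> y = of_bool (y = j) - b" for y :: nat
  have eq: "(real (count_eq n x j) / real n - b)\<^sup>2
      = (\<Sum>i=1..n. \<Sum>k=1..n. \<phi> (x i) * \<phi> (x k)) / (real n)\<^sup>2" for x
  proof -
    have "(\<Sum>i=1..n. \<phi> (x i)) = real n * (real (count_eq n x j) / real n - b)"
      using n by (simp add: \<phi>_def sum_subtractf count_eq_def algebra_simps)
    then have "(\<Sum>i=1..n. \<Sum>k=1..n. \<phi> (x i) * \<phi> (x k)) = (real n)\<^sup>2 * (real (count_eq n x j) / real n - b)\<^sup>2"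
      by (simp add: power2_eq_square flip: sum_product)
    then show ?thesis using n by simp
  qed
  note int = integral_product_pair(1)[OF \<pi>, of _ n _ t \<phi>]
  show "integrable (iid n (mixture t \<pi>)) (\<lambda>x. (real (count_eq n x j) / real n - b_coef j t \<pi>)\<^sup>2)"
    unfolding b_def[symmetric] eq using int
    by (intro Bochner_Integration.integrable_divide Bochner_Integration.integrable_sum) auto
  have \<phi>1: "(\<Sum>l\<le>t. b_coef l t \<pi> * \<phi> l) = 0"
    using j by (simp add: \<phi>_def right_diff_distrib sum_subtractf sum_b_coef[OF \<pi>] b_def
        of_bool_def if_distrib[of "\<lambda>u. _ * u"] flip: sum_distrib_right cong: if_cong)
  have \<phi>2: "(\<Sum>l\<le>t. b_coef l t \<pi> * (\<phi> l)\<^sup>2) = mu b"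
  proof -
    have "b_coef l t \<pi> * (\<phi> l)\<^sup>2 = (if l = j then b * (1 - 2 * b) else 0) + b_coef l t \<pi> * b\<^sup>2" for l
      by (auto simp: \<phi>_def b_def power2_eq_square algebra_simps)
    then have "(\<Sum>l\<le>t. b_coef l t \<pi> * (\<phi> l)\<^sup>2) = b * (1 - 2 * b) + b\<^sup>2"
      using j by (simp add: sum.distrib sum_b_coef[OF \<pi>] flip: sum_distrib_right)
    then show ?thesis by (simp add: mu_def power2_eq_square algebra_simps)
  qed
  have "(\<integral>x. (real (count_eq n x j) / real n - b)\<^sup>2 \<partial>iid n (mixture t \<pi>))
     = (\<Sum>i=1..n. \<Sum>k=1..n. \<integral>x. \<phi> (x i) * \<phi> (x k) \<partial>iid n (mixture t \<pi>)) / (real n)\<^sup>2"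
  proof -
    have "(\<integral>x. (\<Sum>i=1..n. \<Sum>k=1..n. \<phi> (x i) * \<phi> (x k)) \<partial>iid n (mixture t \<pi>))
        = (\<Sum>i=1..n. \<integral>x. (\<Sum>k=1..n. \<phi> (x i) * \<phi> (x k)) \<partial>iid n (mixture t \<pi>))"
      by (intro Bochner_Integration.integral_sum Bochner_Integration.integrable_sum int)
    also have "\<dots> = (\<Sum>i=1..n. \<Sum>k=1..n. \<integral>x. \<phi> (x i) * \<phi> (x k) \<partial>iid n (mixture t \<pi>))"
      by (intro sum.cong refl Bochner_Integration.integral_sum int)
    finally show ?thesis unfolding eq by simp
  qed
  also have "(\<Sum>i=1..n. \<Sum>k=1..n. \<integral>x. \<phi> (x i) * \<phi> (x k) \<partial>iid n (mixture t \<pi>))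
      = (\<Sum>i=1..n. \<Sum>k=1..n. if i = k then mu b else 0)"
    by (intro sum.cong refl) (simp only: integral_product_pair(2)[OF \<pi>] \<phi>1 \<phi>2, simp)
  also have "\<dots> = real n * mu b" by simp
  finally show "(\<integral>x. (real (count_eq n x j) / real n - b_coef j t \<pi>)\<^sup>2 \<partial>iid n (mixture t \<pi>))
          = mu (b_coef j t \<pi>) / real n"
    using n by (simp add: b_def power2_eq_square)
qed

text \<open>The squared distance of two vectors indexed by \<open>{..t}\<close>, weighted by \<open>v\<close>.\<close>
definition sq_dist :: "nat \<Rightarrow> (nat \<Rightarrow> real) \<Rightarrow> (nat \<Rightarrow> real) \<Rightarrow> (nat \<Rightarrow> real) \<Rightarrow> real" where
  "sq_dist t v p q = (\<Sum>j\<le>t. v j * (p j - q j)\<^sup>2)"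

text \<open>The empirical frequency \<open>n\<^sub>j / n\<close> of the value \<open>j\<close> in the sample \<open>x\<close>.\<close>
definition freq :: "nat \<Rightarrow> (nat \<Rightarrow> nat) \<Rightarrow> nat \<Rightarrow> real" where
  "freq n x j = real (count_eq n x j) / real n"

lemma measurable_freq [measurable]:
  "(\<lambda>x. freq n x j) \<in> borel_measurable (iid n (mixture t \<pi>))"
  unfolding freq_def by measurable

lemma measurable_sq_dist_freq [measurable]:
  "(\<lambda>x. sq_dist t v (freq n x) q) \<in> borel_measurable (iid n (mixture t \<pi>))"
  unfolding sq_dist_def by measurable

lemma sq_dist_freq_tail:
  fixes t n :: nat
  assumes \<pi>: "\<pi> \<in> dists01" and n: "0 < n" and c: "0 < c"
    and v: "\<And>j. 0 \<le> v j" "\<And>j. v j \<le> 1"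
  defines "M \<equiv> iid n (mixture t \<pi>)"
  shows "measure M {x \<in> space M. 1 / (real n * c) \<le> sq_dist t v (freq n x) (\<lambda>j. b_coef j t \<pi>)} \<le> c"
proof -
  interpret prob_space M unfolding M_def by (rule prob_space_iid[OF \<pi>])
  let ?D = "\<lambda>x. sq_dist t v (freq n x) (\<lambda>j. b_coef j t \<pi>)"
  have int: "integrable M (\<lambda>x. (freq n x j - b_coef j t \<pi>)\<^sup>2)" if "j \<le> t" for j
    unfolding M_def freq_def by (rule variance_frequency(1)[OF \<pi> that n])
  have intD: "integrable M ?D"
    unfolding sq_dist_def using int by (intro Bochner_Integration.integrable_sum) auto
  have "(\<integral>x. ?D x \<partial>M) = (\<Sum>j\<le>t. v j * (mu (b_coef j t \<pi>) / real n))"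
    unfolding sq_dist_def using int variance_frequency(2)[OF \<pi> _ n]
    by (simp add: Bochner_Integration.integral_sum M_def freq_def)
  also have "\<dots> \<le> (\<Sum>j\<le>t. 1 * (b_coef j t \<pi> / real n))"
  proof (intro sum_mono mult_mono v divide_right_mono)
    fix j assume "j \<in> {..t}"
    then show "mu (b_coef j t \<pi>) \<le> b_coef j t \<pi>" "0 \<le> mu (b_coef j t \<pi>) / real n"
      using b_coef_nonneg[OF \<pi>, of j t] b_coef_le_1[OF \<pi>, of j t]
      by (auto simp: mu_def mult_left_le)
  qed auto
  also have "\<dots> = 1 / real n" by (simp add: sum_b_coef[OF \<pi>] flip: sum_divide_distrib)
  finally have E: "(\<integral>x. ?D x \<partial>M) \<le> 1 / real n" .
  have D0: "0 \<le> ?D x" for x unfolding sq_dist_def by (intro sum_nonneg mult_nonneg_nonneg v) simp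
  have "measure M {x \<in> space M. 1 / (real n * c) \<le> ?D x} \<le> (\<integral>x. ?D x \<partial>M) / (1 / (real n * c))"
    using intD D0 n c by (intro integral_Markov_inequality_measure[where A = "{}"]) auto
  also have "\<dots> \<le> (1 / real n) / (1 / (real n * c))"
    using n c by (intro divide_right_mono E) simp
  also have "\<dots> = c" using n c by simp
  finally show ?thesis .
qed

text \<open>The weight of a cell of null probability \<open>b\<close> in the statistic: the factor \<open>1 / (t + 1)\<close> in front
  of the sum is absorbed into the denominator \<open>max (1 / (t + 1)) (mu b)\<close>.\<close>
definition chi_weight :: "nat \<Rightarrow> real \<Rightarrow> real" where
  "chi_weight t b = 1 / max 1 ((real t + 1) * mu b)"

lemma chi_weight_nonneg: "0 \<le> chi_weight t b"
  and chi_weight_le_1: "chi_weight t b \<le> 1"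
  by (simp_all add: chi_weight_def max_def)

lemma l2_stat_eq:
  "l2_stat t n \<pi>0 x =
     sq_dist t (\<lambda>j. chi_weight t (b_coef j t \<pi>0)) (freq n x) (\<lambda>j. b_coef j t \<pi>0)
     - (\<Sum>j\<le>t. chi_weight t (b_coef j t \<pi>0) * mu (freq n x j)) / (real n - 1)"
proof -
  have w: "1 / (real t + 1) * (y / max (1 / (real t + 1)) m) = y / max 1 ((real t + 1) * m)" for y m
  proof -
    have "(real t + 1) * max (1 / (real t + 1)) m = max 1 ((real t + 1) * m)"
      by (auto simp: max_def field_simps)
    then show ?thesis by (metis divide_divide_eq_left' mult_1 times_divide_eq_left times_divide_times_eq)
  qed
  show ?thesis
    unfolding l2_stat_def sum_distrib_left w K2_def atLeast0AtMost sq_dist_def freq_def chi_weight_def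
      sum_divide_distrib sum_subtractf[symmetric]
    by (intro sum.cong refl) (simp add: diff_divide_distrib)
qed

lemma measurable_l2_stat [measurable]:
  "l2_stat t n \<pi>0 \<in> borel_measurable (iid n (mixture t \<pi>))"
  unfolding l2_stat_eq[abs_def] mu_def
  by (intro borel_measurable_diff borel_measurable_divide borel_measurable_sum borel_measurable_times
      borel_measurable_const measurable_freq measurable_sq_dist_freq)

text \<open>The debiasing term lies between \<open>0\<close> and \<open>1 / (n - 1) \<le> 2 / n\<close>, since the frequencies sum to \<open>1\<close>.\<close>
lemma l2_stat_bounds:
  fixes \<pi>0 :: "real measure"
  assumes n: "2 \<le> n" and x: "x \<in> (\<Pi>\<^sub>E i\<in>{1..n}. {..t})"
  defines "D \<equiv> sq_dist t (\<lambda>j. chi_weight t (b_coef j t \<pi>0)) (freq n x) (\<lambda>j. b_coef j t \<pi>0)"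
  shows "l2_stat t n \<pi>0 x \<le> D" "D - 2 / real n \<le> l2_stat t n \<pi>0 x"
proof -
  define R where "R = (\<Sum>j\<le>t. chi_weight t (b_coef j t \<pi>0) * mu (freq n x j))"
  have f0: "0 \<le> freq n x j" for j by (simp add: freq_def)
  have fs: "(\<Sum>j\<le>t. freq n x j) = 1"
    using sum_count_eq[OF x] n by (simp add: freq_def flip: sum_divide_distrib of_nat_sum)
  have f1: "freq n x j \<le> 1" if "j \<le> t" for j
    unfolding fs[symmetric] using that f0 by (intro member_le_sum) auto
  have m: "0 \<le> mu (freq n x j)" "mu (freq n x j) \<le> freq n x j" if "j \<le> t" for j
    using f0[of j] f1[OF that] by (auto simp: mu_def mult_left_le)
  have R0: "0 \<le> R" unfolding R_def
    by (intro sum_nonneg mult_nonneg_nonneg m) (auto simp: chi_weight_nonneg chi_weight_le_1)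
  have "R \<le> (\<Sum>j\<le>t. 1 * freq n x j)"
    unfolding R_def by (intro sum_mono mult_mono m) (auto simp: chi_weight_nonneg chi_weight_le_1 m)
  then have R1: "R \<le> 1" by (simp add: fs)
  have "R / (real n - 1) \<le> 1 / (real n / 2)" using n R1 R0 by (intro frac_le) auto
  moreover have "0 \<le> R / (real n - 1)" using n R0 by simp
  ultimately show "l2_stat t n \<pi>0 x \<le> D" "D - 2 / real n \<le> l2_stat t n \<pi>0 x"
    unfolding l2_stat_eq D_def R_def by simp_all
qed

text \<open>The infimum that defines the quantile is attained, by continuity from below of the measure.
  The lower bound \<open>c\<close> on \<open>T\<close> and \<open>\<alpha> < 1\<close> are what bounds the set of admissible levels from below.\<close>
lemma upper_quantile:
  fixes T :: "'a \<Rightarrow> real"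
  assumes "prob_space M" and T: "T \<in> borel_measurable M"
    and lower: "\<And>x. x \<in> space M \<Longrightarrow> c \<le> T x"
    and \<alpha>: "\<alpha> < 1"
    and u: "measure M {x \<in> space M. u < T x} \<le> \<alpha>"
  defines "q \<equiv> Inf {u. measure M {x \<in> space M. u < T x} \<le> \<alpha>}"
  shows "q \<le> u" "measure M {x \<in> space M. q < T x} \<le> \<alpha>"
proof -
  interpret prob_space M by fact
  note T [measurable]
  define A where "A = {u. measure M {x \<in> space M. u < T x} \<le> \<alpha>}"
  have bdd: "bdd_below A"
  proof (rule bdd_belowI)
    fix u assume "u \<in> A"
    show "c \<le> u"
    proof (rule ccontr)
      assume "\<not> c \<le> u"
      then have "{x \<in> space M. u < T x} = space M" using lower by force
      then show False using \<open>u \<in> A\<close> \<alpha> by (simp add: A_def prob_space)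
    qed
  qed
  have uA: "u \<in> A" using u by (simp add: A_def)
  then show "q \<le> u" unfolding q_def A_def[symmetric] using bdd by (rule cInf_lower)
  define B where "B k = {x \<in> space M. q + 1 / real (Suc k) < T x}" for k
  have B: "measure M (B k) \<le> \<alpha>" for k
  proof -
    have "Inf A < q + 1 / real (Suc k)" by (simp add: q_def A_def)
    then obtain u' where u': "u' \<in> A" "u' < q + 1 / real (Suc k)"
      using cInf_lessD[of A] uA by blast
    have "measure M (B k) \<le> measure M {x \<in> space M. u' < T x}"
      unfolding B_def by (rule finite_measure_mono) (use u' in auto)
    then show ?thesis using u' by (simp add: A_def)
  qed
  have "(\<lambda>k. measure M (B k)) \<longlonglongrightarrow> measure M (\<Union>k. B k)"
  proof (rule finite_Lim_measure_incseq)
    show "range B \<subseteq> sets M" unfolding B_def by auto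
    show "incseq B"
    proof (rule monoI)
      fix k l :: nat assume "k \<le> l"
      then have "1 / real (Suc l) \<le> 1 / real (Suc k)" by (intro frac_le) auto
      then show "B k \<subseteq> B l" by (auto simp: B_def)
    qed
  qed
  moreover have "(\<Union>k. B k) = {x \<in> space M. q < T x}"
  proof (intro equalityI subsetI)
    fix x assume "x \<in> {x \<in> space M. q < T x}"
    then have x: "x \<in> space M" "0 < T x - q" by auto
    then obtain k where "1 / real (Suc k) < T x - q"
      using nat_approx_posE by blast
    then have "q + 1 / real (Suc k) < T x" by linarith
    then show "x \<in> (\<Union>k. B k)" using x unfolding B_def by blast
  next
    fix x assume "x \<in> (\<Union>k. B k)"
    then obtain k where "x \<in> space M" "q + 1 / real (Suc k) < T x" by (auto simp: B_def)
    moreover have "0 < 1 / real (Suc k)" by simp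
    ultimately have "x \<in> space M \<and> q < T x" by linarith
    then show "x \<in> {x \<in> space M. q < T x}" by simp
  qed
  ultimately have "(\<lambda>k. measure M (B k)) \<longlonglongrightarrow> measure M {x \<in> space M. q < T x}" by simp
  then show "measure M {x \<in> space M. q < T x} \<le> \<alpha>"
    by (rule LIMSEQ_le_const2) (use B in auto)
qed

lemma l2_stat_quantile:
  fixes t n :: nat
  assumes \<pi>0: "\<pi>0 \<in> dists01" and n: "2 \<le> n" and \<alpha>: "0 < \<alpha>" "\<alpha> < 1"
  defines "M \<equiv> iid n (mixture t \<pi>0)"
  defines "q \<equiv> quantile n \<alpha> (mixture t \<pi>0) (l2_stat t n \<pi>0)"
  shows "q \<le> 1 / (real n * \<alpha>)" "measure M {x \<in> space M. q < l2_stat t n \<pi>0 x} \<le> \<alpha>"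
proof -
  interpret prob_space M unfolding M_def by (rule prob_space_iid[OF \<pi>0])
  have bnd: "l2_stat t n \<pi>0 x \<le> sq_dist t (\<lambda>j. chi_weight t (b_coef j t \<pi>0)) (freq n x) (\<lambda>j. b_coef j t \<pi>0)"
    "- 2 / real n \<le> l2_stat t n \<pi>0 x" if "x \<in> space M" for x
  proof -
    note b = l2_stat_bounds[OF n, of x t \<pi>0]
    have x: "x \<in> (\<Pi>\<^sub>E i\<in>{1..n}. {..t})" using that by (simp add: M_def space_iid[OF \<pi>0])
    show "l2_stat t n \<pi>0 x \<le> sq_dist t (\<lambda>j. chi_weight t (b_coef j t \<pi>0)) (freq n x) (\<lambda>j. b_coef j t \<pi>0)"
      by (rule b(1)[OF x])
    have "0 \<le> sq_dist t (\<lambda>j. chi_weight t (b_coef j t \<pi>0)) (freq n x) (\<lambda>j. b_coef j t \<pi>0)"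
      unfolding sq_dist_def by (intro sum_nonneg mult_nonneg_nonneg) (auto simp: chi_weight_nonneg chi_weight_le_1)
    then show "- 2 / real n \<le> l2_stat t n \<pi>0 x" using b(2)[OF x] by simp
  qed
  have meas: "l2_stat t n \<pi>0 \<in> borel_measurable M" unfolding M_def by measurable
  have "measure M {x \<in> space M. 1 / (real n * \<alpha>) < l2_stat t n \<pi>0 x}
     \<le> measure M {x \<in> space M. 1 / (real n * \<alpha>) \<le>
          sq_dist t (\<lambda>j. chi_weight t (b_coef j t \<pi>0)) (freq n x) (\<lambda>j. b_coef j t \<pi>0)}"
  proof (rule finite_measure_mono)
    show "{x \<in> space M. 1 / (real n * \<alpha>) < l2_stat t n \<pi>0 x}
     \<subseteq> {x \<in> space M. 1 / (real n * \<alpha>) \<le>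
          sq_dist t (\<lambda>j. chi_weight t (b_coef j t \<pi>0)) (freq n x) (\<lambda>j. b_coef j t \<pi>0)}"
      using bnd(1) by force
    show "{x \<in> space M. 1 / (real n * \<alpha>) \<le>
          sq_dist t (\<lambda>j. chi_weight t (b_coef j t \<pi>0)) (freq n x) (\<lambda>j. b_coef j t \<pi>0)} \<in> sets M"
      unfolding M_def by measurable
  qed
  also have "\<dots> \<le> \<alpha>"
    unfolding M_def using n \<alpha>
    by (intro sq_dist_freq_tail[OF \<pi>0]) (auto simp: chi_weight_nonneg chi_weight_le_1)
  finally have u: "measure M {x \<in> space M. 1 / (real n * \<alpha>) < l2_stat t n \<pi>0 x} \<le> \<alpha>" .
  note uq = upper_quantile[OF prob_space_axioms meas bnd(2) \<alpha>(2) u]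
  show "q \<le> 1 / (real n * \<alpha>)" "measure M {x \<in> space M. q < l2_stat t n \<pi>0 x} \<le> \<alpha>"
    using uq by (simp_all add: q_def quantile_def M_def)
qed

lemma type2_error_bound:
  assumes \<pi>: "\<pi> \<in> dists01" and \<pi>0: "\<pi>0 \<in> dists01" and n: "2 \<le> n"
    and \<alpha>: "0 < \<alpha>" "\<alpha> < 1" and \<beta>: "0 < \<beta>"
    and sep: "2 * (1 / \<alpha> + 2 + 1 / \<beta>) / real n
      \<le> sq_dist t (\<lambda>j. chi_weight t (b_coef j t \<pi>0)) (\<lambda>j. b_coef j t \<pi>) (\<lambda>j. b_coef j t \<pi>0)"
  defines "M \<equiv> iid n (mixture t \<pi>)"
  shows "emeasure M {x \<in> space M. psi t n \<alpha> \<pi>0 x = 0} \<le> ennreal \<beta>"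
proof -
  interpret prob_space M unfolding M_def by (rule prob_space_iid[OF \<pi>])
  define v where "v j = chi_weight t (b_coef j t \<pi>0)" for j
  have v_eq: "(\<lambda>j. chi_weight t (b_coef j t \<pi>0)) = v" by (simp add: v_def fun_eq_iff)
  have v: "0 \<le> v j" "v j \<le> 1" for j by (simp_all add: v_def chi_weight_nonneg chi_weight_le_1)
  define q where "q = quantile n \<alpha> (mixture t \<pi>0) (l2_stat t n \<pi>0)"
  define B where "B = {x \<in> space M. 1 / (real n * \<beta>) \<le> sq_dist t v (freq n x) (\<lambda>j. b_coef j t \<pi>)}"
  have "x \<in> B" if x: "x \<in> space M" and psi0: "psi t n \<alpha> \<pi>0 x = 0" for x
  proof -
    let ?p = "\<lambda>j. b_coef j t \<pi>" and ?q = "\<lambda>j. b_coef j t \<pi>0"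
    have x': "x \<in> (\<Pi>\<^sub>E i\<in>{1..n}. {..t})" using x by (simp add: M_def space_iid[OF \<pi>])
    have "l2_stat t n \<pi>0 x \<le> q" using psi0 by (simp add: psi_def q_def not_less)
    also have "q \<le> 1 / (real n * \<alpha>)"
      unfolding q_def by (rule l2_stat_quantile[OF \<pi>0 n \<alpha>])
    finally have l: "sq_dist t v (freq n x) ?q \<le> 1 / (real n * \<alpha>) + 2 / real n"
      using l2_stat_bounds(2)[OF n x', of \<pi>0] unfolding v_eq by simp
    have "sq_dist t v ?p ?q \<le> 2 * sq_dist t v (freq n x) ?q + 2 * sq_dist t v (freq n x) ?p"
      unfolding sq_dist_def sum_distrib_left sum.distrib[symmetric]
    proof (rule sum_mono)
      fix j
      let ?y = "freq n x j - ?q j" and ?z = "freq n x j - ?p j"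
      have "(?p j - ?q j)\<^sup>2 + (?y + ?z)\<^sup>2 = 2 * ?y\<^sup>2 + 2 * ?z\<^sup>2"
        by (simp add: power2_eq_square algebra_simps)
      then have "(?p j - ?q j)\<^sup>2 \<le> 2 * ?y\<^sup>2 + 2 * ?z\<^sup>2"
        using zero_le_power2[of "?y + ?z"] by linarith
      from mult_left_mono[OF this v(1)[of j]]
      show "v j * (?p j - ?q j)\<^sup>2 \<le> 2 * (v j * ?y\<^sup>2) + 2 * (v j * ?z\<^sup>2)"
        by (simp add: algebra_simps)
    qed
    moreover have "2 * (1 / \<alpha> + 2 + 1 / \<beta>) / real n
        = 2 * (1 / (real n * \<alpha>) + 2 / real n) + 2 * (1 / (real n * \<beta>))"
      by (simp add: add_divide_distrib mult.commute)
    moreover have "X \<le> S" if "D \<le> 2 * F + 2 * S" "Y = 2 * G + 2 * X" "Y \<le> D" "F \<le> G"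
      for D F G S X Y :: real
      using that by linarith
    ultimately have "1 / (real n * \<beta>) \<le> sq_dist t v (freq n x) ?p"
      using sep l unfolding v_eq by blast
    then show ?thesis using x by (simp add: B_def)
  qed
  then have "{x \<in> space M. psi t n \<alpha> \<pi>0 x = 0} \<subseteq> B" by auto
  moreover have "B \<in> sets M" unfolding B_def M_def by measurable
  ultimately have "emeasure M {x \<in> space M. psi t n \<alpha> \<pi>0 x = 0} \<le> emeasure M B"
    by (rule emeasure_mono)
  also have "\<dots> = ennreal (measure M B)" by (rule emeasure_eq_measure)
  also have "measure M B \<le> \<beta>"
    unfolding B_def M_def using n \<beta> v by (intro sq_dist_freq_tail[OF \<pi>]) auto
  finally show ?thesis by (simp add: ennreal_leI)
qed

section \<open>Separation of Bernstein moments and the rates\<close>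

text \<open>\<open>A\<close> is the bound on the Bernstein coefficients for approximations of degree \<open>m\<close>.\<close>
lemma separation_from_W1:
  assumes \<pi>: "\<pi> \<in> dists01" and \<pi>0: "\<pi>0 \<in> dists01" and m: "m \<le> t" and t: "0 < t"
    and W: "8 / (real m + 1) \<le> W1 \<pi> \<pi>0"
  defines "A \<equiv> 2 * (2 + ln (max 1 (real m))) * ((real t + 1) * exp (2 * (real m)\<^sup>2 / real t))"
  shows "8 / ((real m + 1)\<^sup>2 * (real t + 1) * A\<^sup>2)
    \<le> sq_dist t (\<lambda>j. chi_weight t (b_coef j t \<pi>0)) (\<lambda>j. b_coef j t \<pi>) (\<lambda>j. b_coef j t \<pi>0)"
proof -
  obtain f where f: "1-lipschitz_on {0..1} f" and f1: "\<forall>x\<in>{0..1}. \<bar>f x\<bar> \<le> 1"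
    and Wf: "W1 \<pi> \<pi>0 \<le> (\<integral>x. f x \<partial>\<pi>) - (\<integral>x. f x \<partial>\<pi>0)"
    using W1_le_dual[OF \<pi> \<pi>0] by blast
  obtain a where a1: "\<And>x. x \<in> {0..1} \<Longrightarrow> \<bar>f x - (\<Sum>j\<le>t. a j * bernstein t j x)\<bar> \<le> 2 / (real m + 1)"
    and a2: "\<And>j. j \<le> t \<Longrightarrow> \<bar>a j\<bar> \<le> A"
    using lipschitz_bernstein_approximation[OF f _ m t] f1 unfolding A_def by blast
  have close: "\<bar>(\<integral>x. f x \<partial>\<rho>) - (\<Sum>j\<le>t. a j * b_coef j t \<rho>)\<bar> \<le> 2 / (real m + 1)"
    if \<rho>: "\<rho> \<in> dists01" for \<rho>
  proof -
    interpret prob_space \<rho> using \<rho> by (simp add: dists01_def)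
    have sp: "sets \<rho> = sets (restrict_space borel {0..1})" using \<rho> by (simp add: dists01_def)
    have mf: "f \<in> borel_measurable \<rho>"
      using borel_measurable_continuous_on_restrict[OF lipschitz_on_continuous_on[OF f]]
      by (simp add: measurable_cong_sets[OF sp refl])
    have intf: "integrable \<rho> f"
      by (rule integrable_const_bound[where B = 1, OF AE_I2 mf]) (use f1 space_dists01[OF \<rho>] in auto)
    have intp: "integrable \<rho> (\<lambda>x. \<Sum>j\<le>t. a j * bernstein t j x)"
      using integral_sum_bernstein(1)[OF \<rho>] by (intro Bochner_Integration.integrable_sum) auto
    have "(\<integral>x. f x \<partial>\<rho>) - (\<Sum>j\<le>t. a j * b_coef j t \<rho>)
        = (\<integral>x. f x - (\<Sum>j\<le>t. a j * bernstein t j x) \<partial>\<rho>)"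
      using intf intp by (simp only: Bochner_Integration.integral_diff integral_sum_bernstein(3)[OF \<rho>])
    also have "\<bar>\<dots>\<bar> \<le> (\<integral>x. \<bar>f x - (\<Sum>j\<le>t. a j * bernstein t j x)\<bar> \<partial>\<rho>)"
      by (rule integral_abs_bound)
    also have "\<dots> \<le> 2 / (real m + 1)"
      using intf intp a1 space_dists01[OF \<rho>]
      by (intro integral_le_const integrable_abs Bochner_Integration.integrable_diff AE_I2) auto
    finally show ?thesis .
  qed
  define d where "d j = b_coef j t \<pi> - b_coef j t \<pi>0" for j
  define v where "v j = chi_weight t (b_coef j t \<pi>0)" for j
  have v: "0 < v j" for j by (simp add: v_def chi_weight_def max_def)
  have "8 / (real m + 1) \<le> 4 / (real m + 1) + (\<Sum>j\<le>t. a j * d j)"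
  proof -
    have "(\<Sum>j\<le>t. a j * d j) = (\<Sum>j\<le>t. a j * b_coef j t \<pi>) - (\<Sum>j\<le>t. a j * b_coef j t \<pi>0)"
      by (simp add: d_def right_diff_distrib sum_subtractf)
    then show ?thesis using W Wf close[OF \<pi>] close[OF \<pi>0] by (simp add: abs_le_iff)
  qed
  then have "4 / (real m + 1) \<le> (\<Sum>j\<le>t. a j * d j)" by simp
  also have "\<dots> \<le> (\<Sum>j\<le>t. A * \<bar>d j\<bar>)"
  proof (rule sum_mono)
    fix j assume "j \<in> {..t}"
    then have "\<bar>a j\<bar> * \<bar>d j\<bar> \<le> A * \<bar>d j\<bar>" using a2 by (intro mult_right_mono) auto
    then show "a j * d j \<le> A * \<bar>d j\<bar>" by (simp add: abs_le_iff flip: abs_mult)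
  qed
  also have "\<dots> = A * (\<Sum>j\<le>t. \<bar>d j\<bar>)" by (simp add: sum_distrib_left)
  finally have "(4 / (real m + 1))\<^sup>2 \<le> (A * (\<Sum>j\<le>t. \<bar>d j\<bar>))\<^sup>2"
    by (intro power_mono) simp_all
  also have "\<dots> = A\<^sup>2 * (\<Sum>j\<le>t. \<bar>d j\<bar>)\<^sup>2" by (simp add: power_mult_distrib)
  also have "(\<Sum>j\<le>t. \<bar>d j\<bar>)\<^sup>2 \<le> sq_dist t v (\<lambda>j. b_coef j t \<pi>) (\<lambda>j. b_coef j t \<pi>0) * (2 * (real t + 1))"
  proof -
    have "(\<Sum>j\<le>t. \<bar>d j\<bar>) = (\<Sum>j\<le>t. (sqrt (v j) * \<bar>d j\<bar>) * (1 / sqrt (v j)))"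
      using v by (intro sum.cong refl) (simp add: less_imp_neq[THEN not_sym])
    then have "(\<Sum>j\<le>t. \<bar>d j\<bar>)\<^sup>2
        \<le> (\<Sum>j\<le>t. (sqrt (v j) * \<bar>d j\<bar>)\<^sup>2) * (\<Sum>j\<le>t. (1 / sqrt (v j))\<^sup>2)"
      using Cauchy_Schwarz_ineq_sum by metis
    also have "(\<Sum>j\<le>t. (sqrt (v j) * \<bar>d j\<bar>)\<^sup>2) = sq_dist t v (\<lambda>j. b_coef j t \<pi>) (\<lambda>j. b_coef j t \<pi>0)"
      using v by (simp add: sq_dist_def power_mult_distrib d_def less_imp_le)
    also have "(\<Sum>j\<le>t. (1 / sqrt (v j))\<^sup>2) \<le> (\<Sum>j\<le>t. 1 + (real t + 1) * b_coef j t \<pi>0)"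
    proof (rule sum_mono)
      fix j assume "j \<in> {..t}"
      then have b: "0 \<le> b_coef j t \<pi>0" "b_coef j t \<pi>0 \<le> 1"
        by (auto simp: b_coef_nonneg[OF \<pi>0] b_coef_le_1[OF \<pi>0])
      then have "mu (b_coef j t \<pi>0) \<le> b_coef j t \<pi>0" by (simp add: mu_def mult_left_le)
      then have "(real t + 1) * mu (b_coef j t \<pi>0) \<le> (real t + 1) * b_coef j t \<pi>0"
        by (intro mult_left_mono) simp_all
      moreover have "0 \<le> (real t + 1) * b_coef j t \<pi>0" using b by simp
      moreover have "(1 / sqrt (v j))\<^sup>2 = max 1 ((real t + 1) * mu (b_coef j t \<pi>0))"
        using v[of j] by (simp add: power_divide less_imp_le, simp add: v_def chi_weight_def)
      ultimately show "(1 / sqrt (v j))\<^sup>2 \<le> 1 + (real t + 1) * b_coef j t \<pi>0"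
        by (simp only: max.bounded_iff) linarith
    qed
    also have "\<dots> = 2 * (real t + 1)"
      by (simp add: sum.distrib sum_b_coef[OF \<pi>0] flip: sum_distrib_left)
    finally show ?thesis
      using v by (simp add: sq_dist_def sum_nonneg less_imp_le mult_left_mono)
  qed
  finally have main: "(4 / (real m + 1))\<^sup>2
      \<le> A\<^sup>2 * (sq_dist t v (\<lambda>j. b_coef j t \<pi>) (\<lambda>j. b_coef j t \<pi>0) * (2 * (real t + 1)))"
    by (simp add: mult_left_mono)
  have A: "0 < A"
    unfolding A_def by (simp add: zero_less_mult_iff add_pos_nonneg add_nonneg_pos)
  have "8 / ((real m + 1)\<^sup>2 * (real t + 1) * A\<^sup>2)
      = (4 / (real m + 1))\<^sup>2 / (A\<^sup>2 * (2 * (real t + 1)))"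
  proof -
    have *: "8 / (x * y * z) = (4\<^sup>2 / x) / (z * (2 * y))" for x y z :: real
      by (simp add: mult_ac)
    show ?thesis unfolding power_divide by (rule *)
  qed
  also have "\<dots> \<le> sq_dist t v (\<lambda>j. b_coef j t \<pi>) (\<lambda>j. b_coef j t \<pi>0)"
    using main A by (subst pos_divide_le_eq) (simp_all add: mult_ac)
  finally show ?thesis by (simp add: v_def[abs_def])
qed

text \<open>For \<open>m\<^sup>2 \<le> (d / 2) * t * ln n\<close> and \<open>t \<le> n powr (1 / 4 - d)\<close>, the left-hand side is of order
  \<open>(t * ln n) * t * (t * ln n)\<^sup>2 * n powr (2 * d)\<close>, that is, \<open>(ln n) ^ 3 * n powr (1 - 2 * d)\<close>.\<close>
lemma degree_budget:
  fixes d K :: real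
  assumes d: "0 < d" "d \<le> 1 / 8" and K: "0 < K"
  shows "\<forall>\<^sub>F n :: nat in sequentially. \<forall>t m. 1 \<le> t \<longrightarrow> m \<le> t \<longrightarrow>
      (real m)\<^sup>2 \<le> d / 2 * real t * ln (real n) \<longrightarrow> real t \<le> real n powr (1 / 4 - d) \<longrightarrow>
      K * ((real m + 1)\<^sup>2 * (real t + 1) *
        (2 * (2 + ln (max 1 (real m))) * ((real t + 1) * exp (2 * (real m)\<^sup>2 / real t)))\<^sup>2) \<le> 8 * real n"
proof -
  have "(\<lambda>n. (ln (real n) / real n powr (2 * d / 3)) ^ 3) \<longlonglongrightarrow> 0 ^ 3"
    using d by (intro tendsto_power lim_ln_over_power) simp
  then have "\<forall>\<^sub>F n in sequentially. (ln (real n) / real n powr (2 * d / 3)) ^ 3 < 1 / (108 * K)"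
    using K by (intro order_tendstoD(2)[of _ "0 ^ 3"]) simp_all
  then show ?thesis
    using eventually_ge_at_top[of 3]
  proof eventually_elim
    case (elim n)
    define L where "L = ln (real n)"
    have L1: "1 \<le> L"
      using elim(2) exp_le by (simp add: L_def ln_ge_iff)
    have pow: "(real n powr (2 * d / 3)) ^ 3 = real n powr (2 * d)"
      using elim(2) by (simp add: powr_power)
    have budget: "108 * K * L ^ 3 \<le> real n powr (2 * d)"
    proof -
      have "L ^ 3 / real n powr (2 * d) < 1 / (108 * K)"
        using elim(1) by (simp only: power_divide pow L_def)
      then show ?thesis using elim(2) K by (simp add: field_simps)
    qed
    show ?case
    proof (intro allI impI)
      fix t m :: nat
      assume t: "1 \<le> t" and m: "m \<le> t" and m2: "(real m)\<^sup>2 \<le> d / 2 * real t * ln (real n)"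
        and tn: "real t \<le> real n powr (1 / 4 - d)"
      have t1: "1 \<le> real t" using t by simp
      have tL: "1 \<le> real t * L" using mult_mono[OF t1 L1] t1 by simp
      have "real t \<le> real n powr 1"
        using elim(2) d by (intro order_trans[OF tn] powr_mono) auto
      then have "ln (max 1 (real m)) \<le> L"
        unfolding L_def using m t by (subst ln_le_cancel_iff) auto
      then have f1: "2 * (2 + ln (max 1 (real m))) \<le> 6 * L" using L1 by simp
      have "2 * (real m)\<^sup>2 / real t \<le> d * L"
        using m2 t1 by (simp add: pos_divide_le_eq L_def mult_ac)
      then have e: "exp (2 * (real m)\<^sup>2 / real t) \<le> real n powr d"
        using elim(2) by (simp add: powr_def L_def)
      have f2: "(real t + 1) * exp (2 * (real m)\<^sup>2 / real t) \<le> 2 * real t * real n powr d"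
        using t1 e by (intro mult_mono) auto
      have f3: "2 * (2 + ln (max 1 (real m))) * ((real t + 1) * exp (2 * (real m)\<^sup>2 / real t))
          \<le> 6 * L * (2 * real t * real n powr d)"
        using L1 by (intro mult_mono f1 f2) auto
      have f4: "(2 * (2 + ln (max 1 (real m))) * ((real t + 1) * exp (2 * (real m)\<^sup>2 / real t)))\<^sup>2
          \<le> (6 * L * (2 * real t * real n powr d))\<^sup>2"
        by (intro power_mono f3 mult_nonneg_nonneg add_nonneg_nonneg) auto
      have f5: "(real m + 1)\<^sup>2 \<le> 3 * (real t * L)"
      proof -
        have "(real m + 1)\<^sup>2 + (real m - 1)\<^sup>2 = 2 * (real m)\<^sup>2 + 2"
          by (simp add: power2_eq_square algebra_simps)
        then have "(real m + 1)\<^sup>2 \<le> 2 * (real m)\<^sup>2 + 2"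
          using zero_le_power2[of "real m - 1"] by linarith
        also have "2 * (real m)\<^sup>2 \<le> d * (real t * L)" using m2 by (simp add: L_def)
        also have "\<dots> \<le> 1 * (real t * L)" using d tL by (intro mult_right_mono) auto
        finally show ?thesis using tL by simp
      qed
      have "K * ((real m + 1)\<^sup>2 * (real t + 1) *
        (2 * (2 + ln (max 1 (real m))) * ((real t + 1) * exp (2 * (real m)\<^sup>2 / real t)))\<^sup>2)
        \<le> K * (3 * (real t * L) * (2 * real t) * (6 * L * (2 * real t * real n powr d))\<^sup>2)"
        using K L1 t1 by (intro mult_left_mono mult_mono f4 f5) auto
      also have "\<dots> = 8 * (108 * K * L ^ 3) * real t ^ 4 * (real n powr d)\<^sup>2"
        by (simp add: power_mult_distrib power2_eq_square eval_nat_numeral)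
      also have "\<dots> \<le> 8 * real n powr (2 * d) * (real n powr (1 / 4 - d)) ^ 4 * (real n powr d)\<^sup>2"
        using K L1 by (intro mult_mono power_mono tn budget order.refl) auto
      also have "\<dots> = 8 * real n"
        using elim(2) by (simp add: powr_power mult.assoc powr_add[symmetric])
      finally show "K * ((real m + 1)\<^sup>2 * (real t + 1) *
        (2 * (2 + ln (max 1 (real m))) * ((real t + 1) * exp (2 * (real m)\<^sup>2 / real t)))\<^sup>2) \<le> 8 * real n" .
    qed
  qed
qed

lemma max_type2_error_le:
  fixes \<alpha> \<beta> :: real
  assumes "0 < \<alpha>" "\<alpha> < 1" "0 < \<beta>" and n: "2 \<le> n" and \<pi>0: "\<pi>0 \<in> dists01"
    and m: "m \<le> t" and t: "1 \<le> t"
    and budget: "2 * (1 / \<alpha> + 2 + 1 / \<beta>) * ((real m + 1)\<^sup>2 * (real t + 1) *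
        (2 * (2 + ln (max 1 (real m))) * ((real t + 1) * exp (2 * (real m)\<^sup>2 / real t)))\<^sup>2) \<le> 8 * real n"
    and \<epsilon>: "8 / (real m + 1) \<le> \<epsilon>"
  shows "max_type2_error t n \<alpha> \<pi>0 \<epsilon> \<le> ennreal \<beta>"
  unfolding max_type2_error_def
proof (rule SUP_least)
  fix \<pi> assume "\<pi> \<in> {\<pi> \<in> dists01. W1 \<pi> \<pi>0 \<ge> \<epsilon>}"
  then have \<pi>: "\<pi> \<in> dists01" and W: "8 / (real m + 1) \<le> W1 \<pi> \<pi>0" using \<epsilon> by auto
  define A where "A = 2 * (2 + ln (max 1 (real m))) * ((real t + 1) * exp (2 * (real m)\<^sup>2 / real t))"
  have A: "0 < A" unfolding A_def by (simp add: zero_less_mult_iff add_pos_nonneg add_nonneg_pos)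
  have "2 * (1 / \<alpha> + 2 + 1 / \<beta>) / real n \<le> 8 / ((real m + 1)\<^sup>2 * (real t + 1) * A\<^sup>2)"
    using budget n A unfolding A_def[symmetric]
    by (simp add: pos_divide_le_eq pos_le_divide_eq mult_ac)
  also have "\<dots> \<le> sq_dist t (\<lambda>j. chi_weight t (b_coef j t \<pi>0)) (\<lambda>j. b_coef j t \<pi>) (\<lambda>j. b_coef j t \<pi>0)"
    unfolding A_def by (rule separation_from_W1[OF \<pi> \<pi>0 m _ W]) (use t in simp)
  finally show "emeasure (iid n (mixture t \<pi>)) {x \<in> space (iid n (mixture t \<pi>)). psi t n \<alpha> \<pi>0 x = 0}
      \<le> ennreal \<beta>"
    by (rule type2_error_bound[OF \<pi> \<pi>0 n assms(1-3)])
qed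

theorem theorem2:
  fixes \<alpha> \<beta> :: real
  assumes "0 < \<alpha>" "\<alpha> < 1" "0 < \<beta>" "\<beta> < 1 - \<alpha>"
  shows "(\<forall>t\<ge>1. \<forall>n\<ge>2. \<forall>\<pi>0\<in>dists01.
            measure (iid n (mixture t \<pi>0))
              {x \<in> space (iid n (mixture t \<pi>0)). psi t n \<alpha> \<pi>0 x = 1} \<le> \<alpha>) \<and>
         (\<forall>\<delta>>0. \<exists>C>0. \<exists>c1>0. \<exists>c2>0. \<exists>n0. \<forall>n\<ge>n0. \<forall>t\<ge>1. \<forall>\<pi>0\<in>dists01. \<forall>\<epsilon>.
            (real t \<le> c1 * ln (real n) \<and> \<epsilon> \<ge> C * (1 / real t) \<or>
             c1 * ln (real n) \<le> real t \<and>
             real t \<le> c2 * (real n powr (1 / 4 - \<delta>) / ln (real n) powr (3 / 8)) \<and>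
             \<epsilon> \<ge> C * (1 / sqrt (real t * ln (real n))))
            \<longrightarrow> max_type2_error t n \<alpha> \<pi>0 \<epsilon> \<le> ennreal \<beta>)"
proof (intro conjI allI ballI impI)
  fix t n :: nat and \<pi>0 :: "real measure"
  assume "2 \<le> n" "\<pi>0 \<in> dists01"
  from l2_stat_quantile(2)[OF this(2,1) assms(1,2)]
  show "measure (iid n (mixture t \<pi>0))
      {x \<in> space (iid n (mixture t \<pi>0)). psi t n \<alpha> \<pi>0 x = 1} \<le> \<alpha>"
    unfolding psi_def by (simp only: of_bool_eq_1_iff)
next
  fix \<delta> :: real assume \<delta>: "0 < \<delta>"
  \<comment> \<open>Decreasing \<open>\<delta>\<close> enlarges the range of \<open>t\<close>; with \<open>d \<le> 1/8\<close> this range contains \<open>t \<le> c * ln n\<close> eventually.\<close>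
  define d where "d = min \<delta> (1 / 8)"
  have d: "0 < d" "d \<le> 1 / 8" "d \<le> \<delta>" using \<delta> by (auto simp: d_def)
  define c where "c = d / 2"
  have c: "0 < c" "c \<le> 1" using d by (auto simp: c_def)
  define C where "C = 8 / sqrt c"
  have C8: "8 \<le> C"
    using c by (simp add: C_def pos_le_divide_eq)
  define K where "K = 2 * (1 / \<alpha> + 2 + 1 / \<beta>)"
  have K: "0 < K" using assms unfolding K_def by (intro mult_pos_pos add_pos_pos) auto
  have "(\<lambda>n. ln (real n) / real n powr (1 / 8)) \<longlonglongrightarrow> 0"
    by (intro lim_ln_over_power) simp
  then have "\<forall>\<^sub>F n in sequentially. ln (real n) / real n powr (1 / 8) < 1"
    by (rule order_tendstoD(2)) simp
  then have "\<forall>\<^sub>F n :: nat in sequentially. 3 \<le> n \<and> ln (real n) \<le> real n powr (1 / 8) \<and>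
      (\<forall>t m. 1 \<le> t \<longrightarrow> m \<le> t \<longrightarrow>
      (real m)\<^sup>2 \<le> d / 2 * real t * ln (real n) \<longrightarrow> real t \<le> real n powr (1 / 4 - d) \<longrightarrow>
      K * ((real m + 1)\<^sup>2 * (real t + 1) *
        (2 * (2 + ln (max 1 (real m))) * ((real t + 1) * exp (2 * (real m)\<^sup>2 / real t)))\<^sup>2) \<le> 8 * real n)"
    using eventually_ge_at_top[of 3] degree_budget[OF d(1,2) K]
    by eventually_elim (simp add: pos_divide_less_eq)
  then obtain n0 where n0: "\<And>n. n0 \<le> n \<Longrightarrow> 3 \<le> n"
      "\<And>n. n0 \<le> n \<Longrightarrow> ln (real n) \<le> real n powr (1 / 8)"
      "\<And>n t m. n0 \<le> n \<Longrightarrow> 1 \<le> t \<Longrightarrow> m \<le> t \<Longrightarrow>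
      (real m)\<^sup>2 \<le> d / 2 * real t * ln (real n) \<Longrightarrow> real t \<le> real n powr (1 / 4 - d) \<Longrightarrow>
      K * ((real m + 1)\<^sup>2 * (real t + 1) *
        (2 * (2 + ln (max 1 (real m))) * ((real t + 1) * exp (2 * (real m)\<^sup>2 / real t)))\<^sup>2) \<le> 8 * real n"
    unfolding eventually_sequentially by blast
  have "max_type2_error t n \<alpha> \<pi>0 \<epsilon> \<le> ennreal \<beta>"
    if n: "n0 \<le> n" and t: "1 \<le> t" and \<pi>0: "\<pi>0 \<in> dists01"
      and range: "real t \<le> c * ln (real n) \<and> \<epsilon> \<ge> C * (1 / real t) \<or>
             c * ln (real n) \<le> real t \<and>
             real t \<le> 1 * (real n powr (1 / 4 - \<delta>) / ln (real n) powr (3 / 8)) \<and>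
             \<epsilon> \<ge> C * (1 / sqrt (real t * ln (real n)))"
    for n t \<pi>0 \<epsilon>
  proof -
    define L where "L = ln (real n)"
    have n3: "3 \<le> n" using n0(1) n by simp
    have L1: "1 \<le> L" using n3 exp_le by (simp add: L_def ln_ge_iff)
    have t1: "1 \<le> real t" using t by simp
    have "\<exists>m. m \<le> t \<and> (real m)\<^sup>2 \<le> d / 2 * real t * ln (real n) \<and>
        real t \<le> real n powr (1 / 4 - d) \<and> 8 / (real m + 1) \<le> \<epsilon>"
      using range
    proof (elim disjE conjE)
      assume tL: "real t \<le> c * ln (real n)" and \<epsilon>: "\<epsilon> \<ge> C * (1 / real t)"
      show ?thesis
      proof (intro exI[of _ t] conjI)
        show "(real t)\<^sup>2 \<le> d / 2 * real t * ln (real n)"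
          using mult_left_mono[OF tL, of "real t"] by (simp add: c_def power2_eq_square mult_ac)
        have "real t \<le> 1 * ln (real n)"
          using c L1 by (intro order_trans[OF tL] mult_right_mono) (auto simp: L_def)
        also have "\<dots> \<le> real n powr (1 / 8)" using n0(2)[OF n] by simp
        also have "\<dots> \<le> real n powr (1 / 4 - d)" using n3 d by (intro powr_mono) auto
        finally show "real t \<le> real n powr (1 / 4 - d)" .
        have "8 / (real t + 1) \<le> C / real t" using C8 t1 by (intro frac_le) auto
        then show "8 / (real t + 1) \<le> \<epsilon>" using \<epsilon> by simp
      qed simp
    next
      assume tL: "c * ln (real n) \<le> real t"
        and tn: "real t \<le> 1 * (real n powr (1 / 4 - \<delta>) / ln (real n) powr (3 / 8))"
        and \<epsilon>: "\<epsilon> \<ge> C * (1 / sqrt (real t * ln (real n)))"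
      \<comment> \<open>The largest degree \<open>m\<close> with \<open>m\<^sup>2 \<le> c * t * L\<close>; \<open>C\<close> is chosen so that \<open>8 / y = C / sqrt (t * L)\<close>.\<close>
      define y where "y = sqrt (c * (real t * L))"
      have y0: "0 < y" using c t1 L1 by (simp add: y_def)
      define m where "m = nat \<lfloor>y\<rfloor>"
      have my: "real m \<le> y" "y \<le> real m + 1" using y0 by (auto simp: m_def)
      show ?thesis
      proof (intro exI[of _ m] conjI)
        have "y \<le> sqrt (real t * real t)"
          unfolding y_def using mult_right_mono[OF tL, of "real t"] t1
          by (intro real_sqrt_le_mono) (simp add: L_def mult_ac)
        then have "y \<le> real t" by simp
        then show "m \<le> t" using my by linarith
        have "(real m)\<^sup>2 \<le> y\<^sup>2" using my by (intro power_mono) auto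
        also have "y\<^sup>2 = c * (real t * L)" using c t1 L1 by (simp add: y_def)
        finally show "(real m)\<^sup>2 \<le> d / 2 * real t * ln (real n)" by (simp add: c_def L_def mult_ac)
        have "1 \<le> L powr (3 / 8)" using L1 by (simp add: ge_one_powr_ge_zero)
        then have "real n powr (1 / 4 - \<delta>) / L powr (3 / 8) \<le> real n powr (1 / 4 - \<delta>) / 1"
          by (intro divide_left_mono) auto
        then have "real t \<le> real n powr (1 / 4 - \<delta>)" using tn by (simp add: L_def)
        also have "\<dots> \<le> real n powr (1 / 4 - d)" using n3 d by (intro powr_mono) auto
        finally show "real t \<le> real n powr (1 / 4 - d)" .
        have "8 / (real m + 1) \<le> 8 / y" using my y0 by (intro divide_left_mono) auto
        also have "8 / y = C * (1 / sqrt (real t * L))" by (simp add: y_def C_def real_sqrt_mult)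
        finally show "8 / (real m + 1) \<le> \<epsilon>" using \<epsilon> by (simp add: L_def)
      qed
    qed
    then obtain m where m: "m \<le> t" "(real m)\<^sup>2 \<le> d / 2 * real t * ln (real n)"
        "real t \<le> real n powr (1 / 4 - d)" "8 / (real m + 1) \<le> \<epsilon>" by blast
    show ?thesis
      using n3 by (intro max_type2_error_le[OF assms(1-3) _ \<pi>0 m(1) t n0(3)[OF n t m(1-3), unfolded K_def] m(4)]) simp
  qed
  moreover have "0 < C" using C8 by simp
  ultimately show "\<exists>C>0. \<exists>c1>0. \<exists>c2>0. \<exists>n0. \<forall>n\<ge>n0. \<forall>t\<ge>1. \<forall>\<pi>0\<in>dists01. \<forall>\<epsilon>.
            (real t \<le> c1 * ln (real n) \<and> \<epsilon> \<ge> C * (1 / real t) \<or>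
             c1 * ln (real n) \<le> real t \<and>
             real t \<le> c2 * (real n powr (1 / 4 - \<delta>) / ln (real n) powr (3 / 8)) \<and>
             \<epsilon> \<ge> C * (1 / sqrt (real t * ln (real n))))
            \<longrightarrow> max_type2_error t n \<alpha> \<pi>0 \<epsilon> \<le> ennreal \<beta>"
    using c(1) zero_less_one by blast
qed

end
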